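(* Let $\Omega\subset\mathbb{R}^n$ be an open set. Assume that $B\in C^1(\Omega\times\mathbb{R}\times\mathbb{R}^n;\mathbb{R}^n)$, $c\in C(\Omega\times\mathbb{R}\times\mathbb{R}^n)$ and $f,g\in C(\Omega)$. Suppose that $u\in W^{1,\infty}_{\rm loc}(\Omega)$ is a viscosity subsolution of $$B(x,u,Du)\cdot D^2u\cdot B(x,u,Du)+c(x,u,Du)=f(x)\quad\text{in }\Omega,$$ and a viscosity supersolution of $$B(x,u,Du)\cdot D^2u\cdot B(x,u,Du)+c(x,u,Du)=g(x)\quad\text{in }\Omega.$$ Then $f\le g$ in $\Omega$.
   Context: For $p\in\mathbb{R}^n$ and an $n\times n$ matrix $A$, $p\cdot A\cdot p$ means $p\cdot(Ap)$. Functions in $W^{1,\infty}_{\rm loc}$ are identified with their continuous representatives. Viscosity sense for an equation $B(x,u,Du)\cdot D^2u\cdot B(x,u,Du)+c(x,u,Du)=h(x)$ with $h$ continuous: a continuous $u$ is a viscosity subsolution in $\Omega$ if whenever $\phi\in C^2(\Omega)$, $x_0\in\Omega$ and $u-\phi$ has a local maximum at $x_0$, then $B(x_0,u(x_0),D\phi(x_0))\cdot D^2\phi(x_0)\cdot B(x_0,u(x_0),D\phi(x_0))+c(x_0,u(x_0),D\phi(x_0))\ge h(x_0)$; it is a viscosity supersolution if whenever $u-\phi$ has a local minimum at $x_0$, the same expression is $\le h(x_0)$; a viscosity solution is both. *)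

theory Defs
  imports "HOL-Analysis.Analysis"
begin

definition pderiv_i :: "(real^'n \<Rightarrow> real) \<Rightarrow> 'n \<Rightarrow> real^'n \<Rightarrow> real" where
  "pderiv_i f i x = frechet_derivative f (at x) (axis i 1)"

definition grad :: "(real^'n \<Rightarrow> real) \<Rightarrow> real^'n \<Rightarrow> real^'n" where
  "grad f x = (\<chi> i. pderiv_i f i x)"

definition hess_apply :: "(real^'n \<Rightarrow> real) \<Rightarrow> real^'n \<Rightarrow> real^'n \<Rightarrow> real^'n" where
  "hess_apply f x p = frechet_derivative (grad f) (at x) p"

fun Ck_on :: "nat \<Rightarrow> (real^'n) set \<Rightarrow> (real^'n \<Rightarrow> real) \<Rightarrow> bool" where
  "Ck_on 0 U f = continuous_on U f"
| "Ck_on (Suc k) U f =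
     ((\<forall>x\<in>U. f differentiable (at x)) \<and> continuous_on U f \<and> (\<forall>i. Ck_on k U (pderiv_i f i)))"

definition smooth_on :: "(real^'n) set \<Rightarrow> (real^'n \<Rightarrow> real) \<Rightarrow> bool" where
  "smooth_on U f \<longleftrightarrow> (\<forall>k. Ck_on k U f)"

definition C1_on :: "'a::euclidean_space set \<Rightarrow> ('a \<Rightarrow> 'b::euclidean_space) \<Rightarrow> bool" where
  "C1_on S F \<longleftrightarrow> (\<exists>F' :: 'a \<Rightarrow> 'a \<Rightarrow>\<^sub>L 'b.
      (\<forall>z\<in>S. (F has_derivative blinfun_apply (F' z)) (at z)) \<and> continuous_on S F')"

definition test_fun :: "(real^'n) set \<Rightarrow> (real^'n \<Rightarrow> real) \<Rightarrow> bool" where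
  "test_fun \<Omega> \<phi> \<longleftrightarrow> smooth_on UNIV \<phi> \<and> compact (closure {x. \<phi> x \<noteq> 0})
      \<and> closure {x. \<phi> x \<noteq> 0} \<subseteq> \<Omega>"

text \<open>W^{1,\<infinity>}_loc(\<Omega>) (continuous representative): u continuous on \<Omega> (hence in L^\<infinity>_loc),
  with weak gradient G that is measurable and locally essentially bounded.\<close>
definition W1inf_loc :: "(real^'n) set \<Rightarrow> (real^'n \<Rightarrow> real) \<Rightarrow> bool" where
  "W1inf_loc \<Omega> u \<longleftrightarrow> continuous_on \<Omega> u \<and>
    (\<exists>G :: real^'n \<Rightarrow> real^'n.
       (\<forall>i. (\<lambda>x. G x $ i) \<in> borel_measurable lebesgue) \<and>
       (\<forall>K. compact K \<and> K \<subseteq> \<Omega> \<longrightarrow>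
           (\<exists>M. AE x in lebesgue. x \<in> K \<longrightarrow> norm (G x) \<le> M)) \<and>
       (\<forall>\<phi> i. test_fun \<Omega> \<phi> \<longrightarrow>
           (LINT x:\<Omega>|lebesgue. u x * pderiv_i \<phi> i x) = - (LINT x:\<Omega>|lebesgue. G x $ i * \<phi> x)))"

definition local_max_at :: "(real^'n) set \<Rightarrow> (real^'n \<Rightarrow> real) \<Rightarrow> real^'n \<Rightarrow> bool" where
  "local_max_at \<Omega> w x0 \<longleftrightarrow> (\<exists>e>0. \<forall>y\<in>\<Omega> \<inter> ball x0 e. w y \<le> w x0)"

definition local_min_at :: "(real^'n) set \<Rightarrow> (real^'n \<Rightarrow> real) \<Rightarrow> real^'n \<Rightarrow> bool" where
  "local_min_at \<Omega> w x0 \<longleftrightarrow> (\<exists>e>0. \<forall>y\<in>\<Omega> \<inter> ball x0 e. w x0 \<le> w y)"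

definition visc_op ::
  "(real^'n \<Rightarrow> real \<Rightarrow> real^'n \<Rightarrow> real^'n) \<Rightarrow> (real^'n \<Rightarrow> real \<Rightarrow> real^'n \<Rightarrow> real)
   \<Rightarrow> (real^'n \<Rightarrow> real) \<Rightarrow> (real^'n \<Rightarrow> real) \<Rightarrow> real^'n \<Rightarrow> real" where
  "visc_op B c u \<phi> x0 =
     (let p = B x0 (u x0) (grad \<phi> x0) in p \<bullet> hess_apply \<phi> x0 p + c x0 (u x0) (grad \<phi> x0))"

definition visc_sub where
  "visc_sub \<Omega> B c h u \<longleftrightarrow> continuous_on \<Omega> u \<and>
     (\<forall>\<phi> x0. Ck_on 2 \<Omega> \<phi> \<and> x0 \<in> \<Omega> \<and> local_max_at \<Omega> (\<lambda>x. u x - \<phi> x) x0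
        \<longrightarrow> visc_op B c u \<phi> x0 \<ge> h x0)"

definition visc_super where
  "visc_super \<Omega> B c h u \<longleftrightarrow> continuous_on \<Omega> u \<and>
     (\<forall>\<phi> x0. Ck_on 2 \<Omega> \<phi> \<and> x0 \<in> \<Omega> \<and> local_min_at \<Omega> (\<lambda>x. u x - \<phi> x) x0
        \<longrightarrow> visc_op B c u \<phi> x0 \<le> h x0)"

end

theory Submission
  imports Defs
begin

text \<open>
  Doubling of variables, regularised by sup-convolution. Suppose \<open>f x0 > g x0\<close>. Let \<open>U\<close> and \<open>V\<close> be the
  sup-convolutions with parameter \<open>\<epsilon>\<close> of \<open>u\<close> and \<open>- u\<close> on a small ball around \<open>x0\<close>, and maximise
  \<open>U \<xi> + V \<zeta> - |\<xi> - \<zeta>|\<^sup>2 / (2 \<epsilon>) - K \<epsilon> |\<xi> - x0|\<^sup>2\<close>. As \<open>u\<close> is locally Lipschitz, at the maximum all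
  points and gradients agree up to \<open>O(\<epsilon>)\<close>, hence so do the directions \<open>b1\<close> and \<open>b2\<close> given by \<open>B\<close>.
  Comparing the maximum with its translates by \<open>(t b1, t b2)\<close> and \<open>(- t b1, - t b2)\<close> bounds the sum of the second
  difference quotients of \<open>U\<close> along \<open>b1\<close> and of \<open>V\<close> along \<open>b2\<close> by \<open>|b1 - b2|\<^sup>2 / \<epsilon> + O(\<epsilon>) = O(\<epsilon>)\<close>.

  Because the operator sees the Hessian in the single direction \<open>B\<close>, neither Alexandrov's theorem nor Jensen's
  lemma is needed. At the maximum \<open>U\<close> is semiconvex and touched from above by a paraboloid; maximising over a
  cylinder of size \<open>t\<close> around the segment in direction \<open>b1\<close> produces a nearby point at which \<open>U\<close> is touched
  from above by a quadratic polynomial whose second derivative along \<open>b1\<close> is the second difference quotient at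
  step \<open>t\<close> up to an error \<open>\<eta>\<close>, and whose coefficients stay bounded as \<open>t\<close> tends to 0. The viscosity
  inequalities at these points, for \<open>U\<close> and \<open>V\<close> with the same \<open>t\<close>, give \<open>f x0 - g x0 \<le> o(1)\<close>.
\<close>

section \<open>Quadratic test functions\<close>

text \<open>A quadratic polynomial that vanishes at \<open>a\<close>, has gradient \<open>v\<close>
  there, and has as Hessian \<alpha> times the rank-one matrix of \<open>b\<close> plus
  \<open>2 * M\<close> times the identity. \<open>M\<close> controls the directions orthogonal to
  \<open>b\<close>; \<alpha> then adjusts the second derivative along \<open>b\<close>.\<close>

definition qtest :: "real^'n \<Rightarrow> real \<Rightarrow> real \<Rightarrow> real^'n \<Rightarrow> real^'n \<Rightarrow> real^'n \<Rightarrow> real" where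
  "qtest v \<alpha> M b a x = v \<bullet> (x - a) + \<alpha> / 2 * ((x - a) \<bullet> b)\<^sup>2 + M * ((x - a) \<bullet> (x - a))"

lemma has_derivative_qtest:
  "(qtest v \<alpha> M b a has_derivative
     (\<lambda>h. (v + (\<alpha> * ((x - a) \<bullet> b)) *\<^sub>R b + (2 * M) *\<^sub>R (x - a)) \<bullet> h)) (at x)"
  unfolding qtest_def[abs_def]
  by (auto intro!: derivative_eq_intros
      simp: fun_eq_iff inner_simps inner_commute algebra_simps) (simp add: field_simps)

lemma pderiv_i_qtest:
  "pderiv_i (qtest v \<alpha> M b a) i = (\<lambda>x. v $ i + \<alpha> * ((x - a) \<bullet> b) * b $ i + 2 * M * (x - a) $ i)"
  by (rule ext)
    (simp add: pderiv_i_def frechet_derivative_at[OF has_derivative_qtest, symmetric] inner_axis)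

lemma grad_qtest:
  "grad (qtest v \<alpha> M b a) = (\<lambda>x. v + (\<alpha> * ((x - a) \<bullet> b)) *\<^sub>R b + (2 * M) *\<^sub>R (x - a))"
  by (simp add: fun_eq_iff grad_def pderiv_i_qtest vec_eq_iff)

lemma hess_apply_qtest:
  "hess_apply (qtest v \<alpha> M b a) x p = (\<alpha> * (p \<bullet> b)) *\<^sub>R b + (2 * M) *\<^sub>R p"
proof -
  have "(grad (qtest v \<alpha> M b a) has_derivative (\<lambda>p. (\<alpha> * (p \<bullet> b)) *\<^sub>R b + (2 * M) *\<^sub>R p)) (at x)"
    unfolding grad_qtest
    by (auto intro!: derivative_eq_intros simp: fun_eq_iff inner_simps algebra_simps)
  then show ?thesis
    unfolding hess_apply_def by (simp only: frechet_derivative_at[symmetric])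
qed

lemma has_derivative_pderiv_i_qtest:
  "(pderiv_i (qtest v \<alpha> M b a) i has_derivative (\<lambda>h. \<alpha> * (h \<bullet> b) * b $ i + 2 * M * h $ i)) (at x)"
  unfolding pderiv_i_qtest
  by (rule derivative_eq_intros refl bounded_linear.has_derivative[OF bounded_linear_vec_nth] | simp)+

lemma Ck_on_2_qtest: "Ck_on 2 \<Omega> (qtest v \<alpha> M b a)"
proof -
  have d2: "pderiv_i (pderiv_i (qtest v \<alpha> M b a) i) j = (\<lambda>x. \<alpha> * (axis j 1 \<bullet> b) * b $ i + 2 * M * axis j 1 $ i)" for i j
    unfolding fun_eq_iff pderiv_i_def[of "pderiv_i (qtest v \<alpha> M b a) i"]
    by (simp only: frechet_derivative_at[OF has_derivative_pderiv_i_qtest, symmetric]) simp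
  have d0: "qtest v \<alpha> M b a differentiable at x" for x
    using has_derivative_qtest[of v \<alpha> M b a x] unfolding differentiable_def by blast
  have d1: "pderiv_i (qtest v \<alpha> M b a) i differentiable at x" for i x
    using has_derivative_pderiv_i_qtest[of v \<alpha> M b a i x] unfolding differentiable_def by blast
  show ?thesis
    using d0 d1
    by (simp add: numeral_2_eq_2 d2 continuous_at_imp_continuous_on differentiable_imp_continuous_within)
qed

lemma visc_op_qtest:
  "visc_op B c u (qtest v \<alpha> M b a) a =
     \<alpha> * (B a (u a) v \<bullet> b)\<^sup>2 + 2 * M * (B a (u a) v \<bullet> B a (u a) v) + c a (u a) v"
  by (simp add: visc_op_def grad_qtest hess_apply_qtest Let_def inner_add_right power2_eq_square)

text \<open>Turns touching of \<open>- u\<close> from above into touching of \<open>u\<close> from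
  below, so that the supersolution can be handled through \<open>- u\<close>.\<close>

lemma uminus_qtest: "- qtest v \<alpha> M b a x = qtest (- v) (- \<alpha>) (- M) b a x"
  by (simp add: qtest_def)

lemma qtest_self [simp]: "qtest v \<alpha> M b a a = 0"
  by (simp add: qtest_def)

lemma qtest_le:
  "qtest v \<alpha> M b a x \<le> v \<bullet> (x - a) + (\<bar>\<alpha>\<bar> * (norm b)\<^sup>2 + \<bar>M\<bar>) * (norm (x - a))\<^sup>2"
proof -
  have "((x - a) \<bullet> b)\<^sup>2 \<le> (norm (x - a) * norm b)\<^sup>2"
    using Cauchy_Schwarz_ineq2[of "x - a" b] by (metis abs_ge_zero power2_abs power_mono)
  then have "\<alpha> / 2 * ((x - a) \<bullet> b)\<^sup>2 \<le> \<bar>\<alpha>\<bar> * (norm (x - a) * norm b)\<^sup>2"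
    by (intro mult_mono) auto
  moreover have "M * ((x - a) \<bullet> (x - a)) \<le> \<bar>M\<bar> * (norm (x - a))\<^sup>2"
    by (simp add: power2_norm_eq_inner mult_right_mono)
  ultimately show ?thesis
    by (simp add: qtest_def algebra_simps power_mult_distrib)
qed

section \<open>Touching semiconvex functions by quadratics\<close>

text \<open>Test with a small positive multiple of \<open>v\<close>: the left side is of first
  order, the right side of second order. Hence a paraboloid below and a quadratic above the same
  function at the same point have equal slopes.\<close>

lemma zero_if_inner_le_square:
  fixes v :: "'a::real_inner"
  assumes "e > 0" and le: "\<And>h. norm h < e \<Longrightarrow> v \<bullet> h \<le> C * (norm h)\<^sup>2"
  shows "v = 0"
proof (rule ccontr)
  assume v: "v \<noteq> 0"
  \<comment> \<open>The first bound makes \<open>C * s\<close> at most 1/2, the second keeps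
    \<open>s *\<^sub>R v\<close> within the radius \<open>e\<close>.\<close>
  define s where "s = min (1 / (2 * (\<bar>C\<bar> + 1))) (e / (2 * norm v))"
  have s: "s > 0" "s \<le> 1 / (2 * (\<bar>C\<bar> + 1))" "s * norm v < e"
  proof -
    show "s > 0" using v assms(1) by (simp add: s_def)
    show "s \<le> 1 / (2 * (\<bar>C\<bar> + 1))" by (simp add: s_def)
    have "s \<le> e / (2 * norm v)" by (simp add: s_def)
    then have "s * norm v \<le> e / 2" using v by (simp add: field_simps)
    then show "s * norm v < e" using assms(1) by linarith
  qed
  have "v \<bullet> (s *\<^sub>R v) \<le> C * (norm (s *\<^sub>R v))\<^sup>2"
    using s by (intro le) auto
  then have "s * (norm v)\<^sup>2 \<le> C * s * s * (norm v)\<^sup>2"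
    using s by (simp add: power2_norm_eq_inner[symmetric] power_mult_distrib power2_eq_square algebra_simps)
  then have "1 \<le> C * s"
    using v s by (simp add: field_simps)
  also have "C * s \<le> (\<bar>C\<bar> + 1) * s" using s by (intro mult_right_mono) auto
  also have "\<dots> \<le> 1 / 2" using s by (simp add: field_simps)
  finally show False by simp
qed

text \<open>If \<open>k\<close> is no longer than the nonzero \<open>a\<close>, convexity bounds the
  increment by \<theta> times that of the prolonged step \<open>(1/\<theta>) *\<^sub>R k\<close>,
  which is as long as \<open>a\<close>, and the quadratic bound controls both values. If
  \<open>a\<close> is no longer than \<open>k\<close>, the quadratic bound is enough.\<close>

lemma convex_quadratic_increment:
  fixes H :: "'a::real_inner \<Rightarrow> real"
  assumes cvx: "convex_on UNIV H" and bd: "\<And>h. \<bar>H h\<bar> \<le> C * (norm h)\<^sup>2"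
  shows "H (a + k) - H a \<le> 5 * C * (norm a * norm k + (norm k)\<^sup>2)"
proof (cases "norm k \<le> norm a \<and> a \<noteq> 0")
  case True
  have C: "C \<ge> 0"
    using order_trans[OF abs_ge_zero bd[of a]] True by (simp add: zero_le_mult_iff)
  show ?thesis
  proof (cases "k = 0")
    case False
    define \<theta> where "\<theta> = norm k / norm a"
    have \<theta>: "0 < \<theta>" "\<theta> \<le> 1" using True False by (auto simp: \<theta>_def)
    have nk: "norm ((1/\<theta>) *\<^sub>R k) = norm a"
      using True False by (simp add: \<theta>_def)
    have "a + k = (1 - \<theta>) *\<^sub>R a + \<theta> *\<^sub>R (a + (1/\<theta>) *\<^sub>R k)"
      using \<theta> by (simp add: algebra_simps)
    then have "H (a + k) \<le> (1 - \<theta>) * H a + \<theta> * H (a + (1/\<theta>) *\<^sub>R k)"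
      using convex_onD[OF cvx, of \<theta> a "a + (1/\<theta>) *\<^sub>R k"] \<theta> by simp
    then have "H (a + k) - H a \<le> \<theta> * (H (a + (1/\<theta>) *\<^sub>R k) - H a)"
      by (simp add: algebra_simps)
    also have "\<dots> \<le> \<theta> * (C * (2 * norm a)\<^sup>2 + C * (norm a)\<^sup>2)"
    proof (intro mult_left_mono)
      have "norm (a + (1/\<theta>) *\<^sub>R k) \<le> 2 * norm a"
        using norm_triangle_ineq[of a "(1/\<theta>) *\<^sub>R k"] nk by linarith
      then have "C * (norm (a + (1/\<theta>) *\<^sub>R k))\<^sup>2 \<le> C * (2 * norm a)\<^sup>2"
        using C by (intro mult_left_mono power_mono) auto
      then show "H (a + (1/\<theta>) *\<^sub>R k) - H a \<le> C * (2 * norm a)\<^sup>2 + C * (norm a)\<^sup>2"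
        using bd[of a] bd[of "a + (1/\<theta>) *\<^sub>R k"] by linarith
    qed (use \<theta> in auto)
    also have "\<dots> = 5 * C * (norm a * norm k)"
      using True by (simp add: \<theta>_def power2_eq_square)
    also have "\<dots> \<le> 5 * C * (norm a * norm k + (norm k)\<^sup>2)"
      using C by (intro mult_left_mono) auto
    finally show ?thesis .
  qed (simp)
next
  case False
  then have ak: "norm a \<le> norm k" by auto
  show ?thesis
  proof (cases "k = 0")
    case False
    have C: "C \<ge> 0"
      using order_trans[OF abs_ge_zero bd[of k]] False by (simp add: zero_le_mult_iff)
    have "H (a + k) - H a \<le> C * (norm (a + k))\<^sup>2 + C * (norm a)\<^sup>2"
      using bd[of a] bd[of "a + k"] by linarith
    also have "\<dots> \<le> C * (2 * norm k)\<^sup>2 + C * (norm k)\<^sup>2"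
      using C ak norm_triangle_ineq[of a k] by (intro add_mono mult_left_mono power_mono) auto
    also have "\<dots> = 5 * C * (norm k)\<^sup>2" by simp
    also have "\<dots> \<le> 5 * C * (norm a * norm k + (norm k)\<^sup>2)"
      using C by (intro mult_left_mono) auto
    finally show ?thesis .
  qed simp
qed

text \<open>The convex case applies to \<open>G h + m * (norm h)\<^sup>2\<close> with constant
  \<open>C + m\<close>; removing the square again costs \<open>2 * m\<close>, which gives
  \<open>5 * (C + m) + 2 * m\<close>.\<close>

lemma semiconvex_increment:
  fixes G :: "'a::real_inner \<Rightarrow> real"
  assumes cvx: "convex_on UNIV (\<lambda>h. G h + m * (norm h)\<^sup>2)" and m: "m \<ge> 0"
    and bd: "\<And>h. \<bar>G h\<bar> \<le> C * (norm h)\<^sup>2"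
  shows "G (a + k) - G a \<le> (5 * C + 7 * m) * (norm a * norm k + (norm k)\<^sup>2)"
proof -
  have "\<bar>G h + m * (norm h)\<^sup>2\<bar> \<le> (C + m) * (norm h)\<^sup>2" for h
  proof -
    have "0 \<le> m * (norm h)\<^sup>2" using m by simp
    then show ?thesis using bd[of h] by (simp add: algebra_simps abs_le_iff)
  qed
  from convex_quadratic_increment[OF cvx this, of a k]
  have *: "G (a + k) - G a \<le> 5 * (C + m) * (norm a * norm k + (norm k)\<^sup>2) + m * ((norm a)\<^sup>2 - (norm (a + k))\<^sup>2)"
    by (simp add: algebra_simps)
  have "(norm a)\<^sup>2 - (norm (a + k))\<^sup>2 = - 2 * (a \<bullet> k) - (norm k)\<^sup>2"
    by (simp add: power2_norm_eq_inner inner_simps inner_commute)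
  also have "\<dots> \<le> 2 * (norm a * norm k + (norm k)\<^sup>2)"
    using Cauchy_Schwarz_ineq2[of a k] by (smt (verit) zero_le_power2)
  finally have "m * ((norm a)\<^sup>2 - (norm (a + k))\<^sup>2) \<le> m * (2 * (norm a * norm k + (norm k)\<^sup>2))"
    using m by (rule mult_left_mono)
  with * show ?thesis by (simp add: algebra_simps)
qed

text \<open>A mean value argument in place of second differentiability. Here \<open>qtest\<close> has second derivative
  \<open>\<alpha> * (b \<bullet> b)\<^sup>2 + 2 * M * (b \<bullet> b)\<close> along \<open>b\<close>. The constant \<open>K\<close> does not depend on \<open>t\<close>, so in the limit
  \<open>t \<rightarrow> 0\<close> the operator only sees the second difference of \<open>G\<close> along \<open>b\<close>.\<close>

lemma exists_directional_touching:
  fixes G :: "real^'n \<Rightarrow> real" and b :: "real^'n"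
  assumes cvx: "convex_on UNIV (\<lambda>h. G h + m * (norm h)\<^sup>2)" and m: "m \<ge> 0"
    and bd: "\<And>h. \<bar>G h\<bar> \<le> C * (norm h)\<^sup>2" and C: "C \<ge> 0" and \<eta>: "\<eta> > 0"
  obtains K where "\<And>t. 0 < t \<Longrightarrow> t \<le> 1 \<Longrightarrow>
    \<exists>h v \<alpha> M. norm h \<le> K * t \<and> norm v \<le> K * t \<and> \<bar>\<alpha>\<bar> \<le> K \<and> \<bar>M\<bar> \<le> K \<and>
      \<alpha> * (b \<bullet> b)\<^sup>2 + 2 * M * (b \<bullet> b) \<le> (G (t *\<^sub>R b) + G (- t *\<^sub>R b)) / t\<^sup>2 + \<eta> \<and>
      (\<exists>e>0. \<forall>y\<in>ball h e. G y \<le> G h + qtest v \<alpha> M b h y)"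
proof (cases "b = 0")
  case True
  have G0: "G 0 = 0" using bd[of 0] by simp
  \<comment> \<open>For \<open>b = 0\<close> nothing is asked along \<open>b\<close>, and the
    paraboloid \<open>C * (norm h)\<^sup>2\<close> touches at 0.\<close>
  have "\<exists>h v \<alpha> M. norm h \<le> C * t \<and> norm v \<le> C * t \<and> \<bar>\<alpha>\<bar> \<le> C \<and> \<bar>M\<bar> \<le> C \<and>
      \<alpha> * (b \<bullet> b)\<^sup>2 + 2 * M * (b \<bullet> b) \<le> (G (t *\<^sub>R b) + G (- t *\<^sub>R b)) / t\<^sup>2 + \<eta> \<and>
      (\<exists>e>0. \<forall>y\<in>ball h e. G y \<le> G h + qtest v \<alpha> M b h y)" if "0 < t" for t
  proof (intro exI conjI ballI)
    show "G y \<le> G 0 + qtest 0 0 C b 0 y" for y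
      using bd[of y] by (simp add: qtest_def power2_norm_eq_inner G0 abs_le_iff)
  qed (use True G0 C \<eta> that in \<open>auto intro!: zero_less_one\<close>)
  then show ?thesis using that by blast
next
  case False
  define bb where "bb = b \<bullet> b"
  have bb: "bb > 0" "bb = (norm b)\<^sup>2" using False by (auto simp: bb_def power2_norm_eq_inner)
  have G0: "G 0 = 0" using bd[of 0] by simp
  have contG: "continuous_on UNIV G"
  proof -
    have "continuous_on UNIV (\<lambda>h. (G h + m * (norm h)\<^sup>2) - m * (norm h)\<^sup>2)"
      by (intro continuous_on_diff convex_on_continuous[OF open_UNIV cvx] continuous_intros)
    then show ?thesis by simp
  qed
  define D where "D = 5 * C + 7 * m"
  have D: "D \<ge> 0" using C m by (simp add: D_def)
  have inc: "G (a + k) - G a \<le> D * (norm a * norm k + (norm k)\<^sup>2)" for a k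
    unfolding D_def by (rule semiconvex_increment[OF cvx m bd])
  \<comment> \<open>The terms \<open>D + D\<^sup>2 * bb / \<eta>\<close> absorb the cross term on
    the end faces of the cylinder below; the next two outweigh \<open>G\<close> and the lower-order
    part of \<Psi> on its lateral surface, and 1 makes this strict.\<close>
  define M where "M = D + D\<^sup>2 * bb / \<eta> + C * (norm b + 1)\<^sup>2 + 2 * C * bb + 1"
  have M: "M \<ge> 0" using D C bb \<eta> by (simp add: M_def)
  define K\<alpha> where "K\<alpha> = (2 * C * bb + \<eta> + 2 * M * bb) / bb\<^sup>2"
  define Kv where "Kv = C * norm b + K\<alpha> * (norm b + 1) * bb + 2 * M * (norm b + 1)"
  define K where "K = (norm b + 1) + Kv + K\<alpha> + M"
  have K\<alpha>: "K\<alpha> \<ge> 0" using C bb \<eta> M by (simp add: K\<alpha>_def)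
  have "\<exists>h v \<alpha> M. norm h \<le> K * t \<and> norm v \<le> K * t \<and> \<bar>\<alpha>\<bar> \<le> K \<and> \<bar>M\<bar> \<le> K \<and>
      \<alpha> * (b \<bullet> b)\<^sup>2 + 2 * M * (b \<bullet> b) \<le> (G (t *\<^sub>R b) + G (- t *\<^sub>R b)) / t\<^sup>2 + \<eta> \<and>
      (\<exists>e>0. \<forall>y\<in>ball h e. G y \<le> G h + qtest v \<alpha> M b h y)" if t: "0 < t" "t \<le> 1" for t
  proof -
    \<comment> \<open>The parabola \<open>l * s + \<beta> * s\<^sup>2 / 2\<close> interpolates
      \<open>G\<close> at the points \<open>s *\<^sub>R b\<close> for
      \<open>s = - t, 0, t\<close>.\<close>
    define \<beta> where "\<beta> = (G (t *\<^sub>R b) + G (- t *\<^sub>R b)) / t\<^sup>2"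
    define l where "l = (G (t *\<^sub>R b) - G (- t *\<^sub>R b)) / (2 * t)"
    have Gp: "G (t *\<^sub>R b) = l * t + \<beta> * t\<^sup>2 / 2" and Gm: "G (- t *\<^sub>R b) = - l * t + \<beta> * t\<^sup>2 / 2"
      using t by (auto simp: \<beta>_def l_def field_simps)
    have bdp: "\<bar>G (t *\<^sub>R b)\<bar> \<le> C * bb * t\<^sup>2" "\<bar>G (- t *\<^sub>R b)\<bar> \<le> C * bb * t\<^sup>2"
      using bd[of "t *\<^sub>R b"] bd[of "- t *\<^sub>R b"] by (auto simp: bb power_mult_distrib algebra_simps)
    have \<beta>: "\<bar>\<beta>\<bar> \<le> 2 * C * bb"
      using bdp t by (simp add: \<beta>_def field_simps abs_le_iff)
    have l: "\<bar>l\<bar> \<le> C * bb * t"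
      using bdp t by (simp add: l_def field_simps abs_le_iff power2_eq_square)
    \<comment> \<open>Here \<open>s h *\<^sub>R b\<close> is the orthogonal projection of
      \<open>h\<close> onto the line of \<open>b\<close>, and \<open>k h\<close> is the
      remainder.\<close>
    define s where "s = (\<lambda>h. (h \<bullet> b) / bb)"
    define k where "k = (\<lambda>h. h - s h *\<^sub>R b)"
    have h_eq: "h = s h *\<^sub>R b + k h" for h by (simp add: k_def)
    have kb: "k h \<bullet> b = 0" for h
      using bb by (simp add: k_def s_def inner_diff_left bb_def)
    have k2: "(norm (k h))\<^sup>2 = h \<bullet> h - (s h)\<^sup>2 * bb" for h
    proof -
      have "h \<bullet> h = (s h *\<^sub>R b + k h) \<bullet> (s h *\<^sub>R b + k h)" using h_eq by simp
      also have "\<dots> = (s h)\<^sup>2 * bb + k h \<bullet> k h"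
        using kb[of h] by (simp add: inner_simps inner_commute power2_eq_square bb_def)
      finally show ?thesis by (simp add: power2_norm_eq_inner)
    qed
    \<comment> \<open>Chosen so that
      \<open>\<alpha> * bb\<^sup>2 + 2 * M * bb = \<beta> + \<eta>\<close>, the second derivative of
      \<Psi> along \<open>b\<close>.\<close>
    define \<alpha> where "\<alpha> = (\<beta> + \<eta> - 2 * M * bb) / bb\<^sup>2"
    define \<Psi> where "\<Psi> = (\<lambda>h. l * s h + (\<beta> + \<eta>) / 2 * (s h)\<^sup>2 + M * (norm (k h))\<^sup>2)"
    have \<alpha>: "\<bar>\<alpha>\<bar> \<le> K\<alpha>"
    proof -
      have "\<bar>\<beta> + \<eta> - 2 * M * bb\<bar> \<le> 2 * C * bb + \<eta> + 2 * M * bb"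
        using \<beta> \<eta> mult_nonneg_nonneg[OF M less_imp_le[OF bb(1)]] by linarith
      then show ?thesis using bb by (simp add: \<alpha>_def K\<alpha>_def divide_right_mono)
    qed
    have \<Psi>_eq: "\<Psi> h = (l / bb) * (h \<bullet> b) + \<alpha> / 2 * (h \<bullet> b)\<^sup>2 + M * (h \<bullet> h)" for h
      unfolding \<Psi>_def k2 using bb
      by (simp add: s_def \<alpha>_def field_simps power2_eq_square)
    \<comment> \<open>Maximise \<open>G - \<Psi>\<close> over a cylinder around the segment from \<open>- t *\<^sub>R b\<close> to \<open>t *\<^sub>R b\<close>. The function \<open>\<Psi>\<close>
      exceeds \<open>G\<close> by \<open>\<eta> / 2 * t\<^sup>2\<close> at both end points, and \<open>M\<close> is so large that \<open>\<Psi> > G\<close> on the whole boundary.\<close>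
    define T where "T = {h. \<bar>s h\<bar> \<le> t \<and> norm (k h) \<le> t}"
    have conts: "continuous_on UNIV s" "continuous_on UNIV k"
      unfolding k_def s_def using bb by (auto intro!: continuous_intros)
    have Tn: "norm h \<le> (norm b + 1) * t" if "h \<in> T" for h
    proof -
      have "norm h \<le> norm (s h *\<^sub>R b) + norm (k h)" by (metis h_eq norm_triangle_ineq)
      also have "\<dots> \<le> t * norm b + t"
        using that by (auto simp: T_def intro!: add_mono mult_right_mono)
      finally show ?thesis by (simp add: algebra_simps)
    qed
    have "closed T" unfolding T_def
      by (intro closed_Collect_conj closed_Collect_le continuous_intros conts)
    moreover have "bounded T" using Tn by (auto simp: bounded_iff)
    ultimately have "compact T" by (simp add: compact_eq_bounded_closed)
    moreover have "0 \<in> T" using t by (simp add: T_def s_def k_def)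
    moreover have "continuous_on T (\<lambda>h. G h - \<Psi> h)"
      unfolding \<Psi>_def by (intro continuous_intros continuous_on_subset[OF contG] conts[THEN continuous_on_subset]) auto
    ultimately obtain h where h: "h \<in> T" and hmax: "\<And>y. y \<in> T \<Longrightarrow> G y - \<Psi> y \<le> G h - \<Psi> h"
      using continuous_attains_sup[of T "\<lambda>h. G h - \<Psi> h"] by auto
    \<comment> \<open>The centre gives the value 0, so no point where \<open>G - \<Psi>\<close> is
      negative can be the maximum.\<close>
    have ge0: "G h - \<Psi> h \<ge> 0"
      using hmax[OF \<open>0 \<in> T\<close>] by (simp add: \<Psi>_def G0 s_def k_def)
    have less_s: "\<bar>s h\<bar> < t"
    proof (rule ccontr)
      assume "\<not> \<bar>s h\<bar> < t"
      then have st: "s h = t \<or> s h = - t" using h by (auto simp: T_def)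
      then have s2: "(s h)\<^sup>2 = t\<^sup>2" by auto
      \<comment> \<open>On an end face, \<open>h\<close> is compared with the end point
        \<open>s h *\<^sub>R b\<close> of the segment, where \<open>G\<close> equals the
        interpolating parabola.\<close>
      have Gs: "G (s h *\<^sub>R b) = l * s h + \<beta> * t\<^sup>2 / 2" using st Gp Gm by auto
      have "G h - G (s h *\<^sub>R b) \<le> D * (norm (s h *\<^sub>R b) * norm (k h) + (norm (k h))\<^sup>2)"
        using inc[of "s h *\<^sub>R b" "k h"] h_eq[of h] by simp
      also have "norm (s h *\<^sub>R b) = t * norm b" using st t by auto
      finally have 1: "G h - \<Psi> h \<le> - \<eta> / 2 * t\<^sup>2 + D * t * norm b * norm (k h) + (D - M) * (norm (k h))\<^sup>2"
        unfolding Gs \<Psi>_def s2 by (simp add: algebra_simps add_divide_distrib)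
      \<comment> \<open>Young's inequality: the cross term costs half of the gain
        \<open>\<eta> / 2 * t\<^sup>2\<close> and a multiple of \<open>(norm (k h))\<^sup>2\<close>
        that \<open>M\<close> absorbs.\<close>
      have "0 \<le> (\<eta> / 2 * t - D * norm b * norm (k h))\<^sup>2" by simp
      then have "D * t * norm b * norm (k h) * \<eta> \<le> (\<eta>/2)\<^sup>2 * t\<^sup>2 + D\<^sup>2 * bb * (norm (k h))\<^sup>2"
        unfolding bb(2) by (simp add: power2_diff power_mult_distrib power_divide algebra_simps)
      then have 2: "D * t * norm b * norm (k h) \<le> \<eta> / 4 * t\<^sup>2 + D\<^sup>2 * bb / \<eta> * (norm (k h))\<^sup>2"
        using \<eta> by (simp add: field_simps power2_eq_square)
      have "D - M \<le> - (D\<^sup>2 * bb / \<eta>)"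
      proof -
        have "0 \<le> C * (norm b + 1)\<^sup>2" "0 \<le> C * bb" using C bb by auto
        then show ?thesis unfolding M_def by linarith
      qed
      then have "(D - M) * (norm (k h))\<^sup>2 \<le> - (D\<^sup>2 * bb / \<eta>) * (norm (k h))\<^sup>2"
        by (rule mult_right_mono) simp
      with 1 2 have "G h - \<Psi> h \<le> - \<eta> / 4 * t\<^sup>2" by (simp add: algebra_simps)
      also have "\<dots> < 0" using \<eta> t by simp
      finally show False using ge0 by simp
    qed
    have less_k: "norm (k h) < t"
    proof (rule ccontr)
      assume "\<not> norm (k h) < t"
      then have kt: "norm (k h) = t" using h by (auto simp: T_def)
      \<comment> \<open>On the lateral surface all terms are at most of order
        \<open>t\<^sup>2\<close>, and the term \<open>M * t\<^sup>2\<close> dominates.\<close>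
      have 1: "G h \<le> C * (norm b + 1)\<^sup>2 * t\<^sup>2"
      proof -
        have "C * (norm h)\<^sup>2 \<le> C * ((norm b + 1) * t)\<^sup>2"
          using Tn[OF h] C by (intro mult_left_mono power_mono) auto
        then show ?thesis using bd[of h] by (simp add: power_mult_distrib abs_le_iff mult.assoc)
      qed
      have sh: "\<bar>s h\<bar> \<le> t" "(s h)\<^sup>2 \<le> t\<^sup>2" using less_s t by (auto intro: power2_le_iff_abs_le[THEN iffD2])
      have "\<bar>l * s h\<bar> \<le> (C * bb * t) * t"
        unfolding abs_mult using l sh t by (intro mult_mono) auto
      then have 2: "- (l * s h) \<le> C * bb * t\<^sup>2" by (simp add: power2_eq_square abs_le_iff)
      have 3: "- ((\<beta> + \<eta>) / 2 * (s h)\<^sup>2) \<le> C * bb * t\<^sup>2"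
      proof -
        have "- ((\<beta> + \<eta>) / 2 * (s h)\<^sup>2) = - ((\<beta> + \<eta>) / 2) * (s h)\<^sup>2" by simp
        also have "\<dots> \<le> (C * bb) * (s h)\<^sup>2"
          using \<beta> \<eta> abs_ge_minus_self[of \<beta>] by (intro mult_right_mono) (simp_all add: field_simps)
        also have "\<dots> \<le> (C * bb) * t\<^sup>2" using sh C bb by (intro mult_left_mono) auto
        finally show ?thesis .
      qed
      have "G h - \<Psi> h \<le> (C * (norm b + 1)\<^sup>2 + 2 * C * bb - M) * t\<^sup>2"
        using 1 2 3 unfolding \<Psi>_def kt by (simp add: algebra_simps)
      moreover have "C * (norm b + 1)\<^sup>2 + 2 * C * bb - M < 0"
      proof -
        have "0 \<le> D\<^sup>2 * bb / \<eta>" using \<eta> bb by simp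
        then show ?thesis using D unfolding M_def by linarith
      qed
      ultimately have "G h - \<Psi> h < 0"
        using t by (smt (verit) mult_neg_pos zero_less_power2)
      then show False using ge0 by simp
    qed
    \<comment> \<open>The gradient of \<Psi> at \<open>h\<close>. Expanding \<Psi> about this
      interior maximum turns maximality into touching by \<open>qtest\<close>.\<close>
    define v where "v = (l / bb + \<alpha> * (h \<bullet> b)) *\<^sub>R b + (2 * M) *\<^sub>R h"
    have \<Psi>_shift: "\<Psi> y = \<Psi> h + qtest v \<alpha> M b h y" for y
      unfolding \<Psi>_eq qtest_def v_def using bb(1)
      by (simp add: inner_simps inner_commute power2_eq_square field_simps)
    have "open {h. \<bar>s h\<bar> < t \<and> norm (k h) < t}"
      by (intro open_Collect_conj open_Collect_less continuous_intros conts)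
    then obtain e where e: "e > 0" "ball h e \<subseteq> {h. \<bar>s h\<bar> < t \<and> norm (k h) < t}"
      using less_s less_k by (metis (mono_tags, lifting) mem_Collect_eq open_contains_ball)
    show ?thesis
    proof (rule exI[of _ h], rule exI[of _ v], rule exI[of _ \<alpha>], rule exI[of _ M], intro conjI)
      have nh: "norm h \<le> (norm b + 1) * t" by (rule Tn[OF h])
      have pos: "0 \<le> Kv" "0 \<le> norm b + 1"
        using C K\<alpha> bb M by (auto simp: Kv_def)
      show "norm h \<le> K * t"
        by (rule order_trans[OF nh]) (use t pos K\<alpha> M in \<open>auto simp: K_def intro!: mult_right_mono\<close>)
      show "\<bar>\<alpha>\<bar> \<le> K" "\<bar>M\<bar> \<le> K" using \<alpha> M pos K\<alpha> unfolding K_def by linarith+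
      have "norm v \<le> norm ((l / bb + \<alpha> * (h \<bullet> b)) *\<^sub>R b) + norm ((2 * M) *\<^sub>R h)"
        unfolding v_def by (rule norm_triangle_ineq)
      also have "\<dots> = \<bar>l / bb + \<alpha> * (h \<bullet> b)\<bar> * norm b + 2 * M * norm h" using M by simp
      also have "\<dots> \<le> (C * t + K\<alpha> * ((norm b + 1) * t * norm b)) * norm b + 2 * M * ((norm b + 1) * t)"
      proof (intro add_mono mult_right_mono mult_left_mono nh)
        have "\<bar>l / bb\<bar> \<le> C * t" using l bb by (simp add: field_simps)
        moreover have "\<bar>\<alpha> * (h \<bullet> b)\<bar> \<le> K\<alpha> * ((norm b + 1) * t * norm b)"
          unfolding abs_mult
          by (intro mult_mono order_trans[OF Cauchy_Schwarz_ineq2] \<alpha> nh K\<alpha> mult_right_mono) auto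
        ultimately show "\<bar>l / bb + \<alpha> * (h \<bullet> b)\<bar> \<le> C * t + K\<alpha> * ((norm b + 1) * t * norm b)"
          by linarith
      qed (use M in auto)
      also have "\<dots> = Kv * t"
        unfolding bb(2) Kv_def by (simp add: power2_eq_square algebra_simps)
      also have "\<dots> \<le> K * t"
        using t pos K\<alpha> M by (intro mult_right_mono) (auto simp: K_def)
      finally show "norm v \<le> K * t" .
      show "\<alpha> * (b \<bullet> b)\<^sup>2 + 2 * M * (b \<bullet> b) \<le> (G (t *\<^sub>R b) + G (- t *\<^sub>R b)) / t\<^sup>2 + \<eta>"
        using bb unfolding \<beta>_def[symmetric] bb_def[symmetric] by (simp add: \<alpha>_def)
      have "G y \<le> G h + qtest v \<alpha> M b h y" if "y \<in> ball h e" for y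
        using hmax[of y] e that \<Psi>_shift[of y] by (force simp: T_def)
      then show "\<exists>e>0. \<forall>y\<in>ball h e. G y \<le> G h + qtest v \<alpha> M b h y"
        using e(1) by blast
    qed
  qed
  then show ?thesis using that by blast
qed

section \<open>Sup-convolution\<close>

text \<open>The supremum runs over \<open>R\<close> only, while \<xi> ranges over the whole space:
  only values of \<open>v\<close> on \<open>R\<close> enter, and semiconvexity holds
  globally.\<close>

definition supconv :: "'a::real_inner set \<Rightarrow> real \<Rightarrow> ('a \<Rightarrow> real) \<Rightarrow> 'a \<Rightarrow> real" where
  "supconv R \<epsilon> v \<xi> = (SUP x\<in>R. v x - (norm (x - \<xi>))\<^sup>2 / (2 * \<epsilon>))"

context
  fixes R :: "'a::real_inner set" and \<epsilon> :: real and v :: "'a \<Rightarrow> real"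
  assumes R: "compact R" "R \<noteq> {}" and v: "continuous_on R v" and \<epsilon>: "\<epsilon> > 0"
begin

lemma supconv_attained:
  obtains x where "x \<in> R" "supconv R \<epsilon> v \<xi> = v x - (norm (x - \<xi>))\<^sup>2 / (2 * \<epsilon>)"
    and "\<And>y \<xi>'. y \<in> R \<Longrightarrow> v y - (norm (y - \<xi>'))\<^sup>2 / (2 * \<epsilon>) \<le> supconv R \<epsilon> v \<xi>'"
proof -
  have ex: "\<exists>x\<in>R. \<forall>y\<in>R. v y - (norm (y - \<xi>))\<^sup>2 / (2 * \<epsilon>) \<le> v x - (norm (x - \<xi>))\<^sup>2 / (2 * \<epsilon>)" for \<xi>
    using \<epsilon> by (intro continuous_attains_sup R continuous_intros v) auto
  have eq: "\<exists>x\<in>R. supconv R \<epsilon> v \<xi> = v x - (norm (x - \<xi>))\<^sup>2 / (2 * \<epsilon>) \<and>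
      (\<forall>y\<in>R. v y - (norm (y - \<xi>))\<^sup>2 / (2 * \<epsilon>) \<le> supconv R \<epsilon> v \<xi>)" for \<xi>
  proof -
    obtain x where x: "x \<in> R" "\<forall>y\<in>R. v y - (norm (y - \<xi>))\<^sup>2 / (2 * \<epsilon>) \<le> v x - (norm (x - \<xi>))\<^sup>2 / (2 * \<epsilon>)"
      using ex by blast
    then have "supconv R \<epsilon> v \<xi> = v x - (norm (x - \<xi>))\<^sup>2 / (2 * \<epsilon>)"
      unfolding supconv_def by (intro cSup_eq_maximum) auto
    with x show ?thesis by auto
  qed
  with that show ?thesis by blast
qed

lemma supconv_upper: "y \<in> R \<Longrightarrow> v y - (norm (y - \<xi>))\<^sup>2 / (2 * \<epsilon>) \<le> supconv R \<epsilon> v \<xi>"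
  using supconv_attained by blast

text \<open>After adding \<open>(norm \<xi>)\<^sup>2 / (2 * \<epsilon>)\<close>, each competitor
  \<open>x\<close> contributes an affine function \<open>?g x\<close> of \<xi>, and a supremum of
  affine functions is convex.\<close>

lemma convex_on_supconv: "convex_on UNIV (\<lambda>\<xi>. supconv R \<epsilon> v \<xi> + (norm \<xi>)\<^sup>2 / (2 * \<epsilon>))"
proof (rule convex_onI)
  fix t :: real and a b :: 'a assume t: "0 < t" "t < 1"
  let ?g = "\<lambda>x \<xi>. v x - (norm x)\<^sup>2 / (2 * \<epsilon>) + (x \<bullet> \<xi>) / \<epsilon>"
  have g: "v x - (norm (x - \<xi>))\<^sup>2 / (2 * \<epsilon>) + (norm \<xi>)\<^sup>2 / (2 * \<epsilon>) = ?g x \<xi>" for x \<xi>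
    using \<epsilon> by (simp add: power2_norm_eq_inner inner_simps inner_commute field_simps)
  let ?c = "(1 - t) *\<^sub>R a + t *\<^sub>R b"
  obtain x where x: "x \<in> R" "supconv R \<epsilon> v ?c = v x - (norm (x - ?c))\<^sup>2 / (2 * \<epsilon>)"
    using supconv_attained by blast
  have "supconv R \<epsilon> v ?c + (norm ?c)\<^sup>2 / (2 * \<epsilon>) = ?g x ?c"
    using x g by simp
  also have "\<dots> = (1 - t) * ?g x a + t * ?g x b"
    using \<epsilon> by (simp add: inner_simps field_simps)
  also have "\<dots> \<le> (1 - t) * (supconv R \<epsilon> v a + (norm a)\<^sup>2 / (2 * \<epsilon>)) + t * (supconv R \<epsilon> v b + (norm b)\<^sup>2 / (2 * \<epsilon>))"
    unfolding g[symmetric] using t supconv_upper[OF x(1)] by (intro add_mono mult_left_mono) auto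
  finally show "supconv R \<epsilon> v ?c + (norm ?c)\<^sup>2 / (2 * \<epsilon>)
      \<le> (1 - t) * (supconv R \<epsilon> v a + (norm a)\<^sup>2 / (2 * \<epsilon>)) + t * (supconv R \<epsilon> v b + (norm b)\<^sup>2 / (2 * \<epsilon>))" .
qed simp

text \<open>The maximiser \<open>x\<close> for \<xi> remains a competitor at
  \<open>\<xi> + h\<close>; expanding its penalty gives a paraboloid from below.\<close>

lemma supconv_lower_paraboloid:
  assumes "x \<in> R" "supconv R \<epsilon> v \<xi> = v x - (norm (x - \<xi>))\<^sup>2 / (2 * \<epsilon>)"
  shows "supconv R \<epsilon> v \<xi> + ((x - \<xi>) /\<^sub>R \<epsilon>) \<bullet> h - (norm h)\<^sup>2 / (2 * \<epsilon>) \<le> supconv R \<epsilon> v (\<xi> + h)"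
proof -
  have "v x - (norm (x - (\<xi> + h)))\<^sup>2 / (2 * \<epsilon>) \<le> supconv R \<epsilon> v (\<xi> + h)"
    by (rule supconv_upper[OF assms(1)])
  moreover have "(norm (x - (\<xi> + h)))\<^sup>2 = (norm (x - \<xi>))\<^sup>2 - 2 * ((x - \<xi>) \<bullet> h) + (norm h)\<^sup>2"
    by (simp add: power2_norm_eq_inner inner_simps inner_commute)
  moreover have "((x - \<xi>) /\<^sub>R \<epsilon>) \<bullet> h = ((x - \<xi>) \<bullet> h) / \<epsilon>"
    by (simp add: divide_inverse_commute)
  moreover have "v x - a / (2 * \<epsilon>) + c / \<epsilon> - d / (2 * \<epsilon>) = v x - (a - 2 * c + d) / (2 * \<epsilon>)" for a c d
    using \<epsilon> by (simp add: field_simps)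
  ultimately show ?thesis
    unfolding assms(2) by (simp only:)
qed

end

lemma continuous_on_supconv:
  fixes R :: "'a::euclidean_space set"
  assumes "compact R" "R \<noteq> {}" "continuous_on R v" "\<epsilon> > 0"
  shows "continuous_on UNIV (supconv R \<epsilon> v)"
proof -
  have "continuous_on UNIV (\<lambda>\<xi>. (supconv R \<epsilon> v \<xi> + (norm \<xi>)\<^sup>2 / (2 * \<epsilon>)) - (norm \<xi>)\<^sup>2 / (2 * \<epsilon>))"
    using assms(4) by (intro continuous_on_diff convex_on_continuous[OF open_UNIV convex_on_supconv[OF assms]] continuous_intros) auto
  then show ?thesis by simp
qed

section \<open>From the sup-convolution back to the original function\<close>

text \<open>A quadratic touching the sup-convolution at \<xi> also touches \<open>v\<close>, after
  translation, at the maximiser \<open>x\<close> belonging to \<xi>. The slope \<open>q\<close>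
  determines \<open>x\<close> as \<open>\<xi> + \<epsilon> *\<^sub>R q\<close>, so \<open>x\<close>
  is as close to \<open>x'\<close> as \<xi> and \<open>q\<close> are to \<open>\<xi>'\<close> and
  \<open>p\<close>, up to a constant factor.\<close>

lemma supconv_jets:
  fixes R :: "(real^'n) set" and b :: "real^'n"
  assumes R: "compact R" "R \<noteq> {}" and v: "continuous_on R v" and \<epsilon>: "\<epsilon> > 0"
    and x': "x' \<in> R" "supconv R \<epsilon> v \<xi>' = v x' - (norm (x' - \<xi>'))\<^sup>2 / (2 * \<epsilon>)"
    and p: "p = (x' - \<xi>') /\<^sub>R \<epsilon>"
    and upper: "\<And>h. supconv R \<epsilon> v (\<xi>' + h) \<le> supconv R \<epsilon> v \<xi>' + p \<bullet> h + C * (norm h)\<^sup>2"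
    and \<eta>: "\<eta> > 0"
  obtains K where "\<And>t. 0 < t \<Longrightarrow> t \<le> 1 \<Longrightarrow>
    \<exists>x q \<alpha> M. x \<in> R \<and> norm (x - x') \<le> K * t \<and> norm (q - p) \<le> K * t \<and> \<bar>\<alpha>\<bar> \<le> K \<and> \<bar>M\<bar> \<le> K \<and>
      \<alpha> * (b \<bullet> b)\<^sup>2 + 2 * M * (b \<bullet> b) \<le> (supconv R \<epsilon> v (\<xi>' + t *\<^sub>R b) + supconv R \<epsilon> v (\<xi>' - t *\<^sub>R b)
         - 2 * supconv R \<epsilon> v \<xi>') / t\<^sup>2 + \<eta> \<and>
      (\<exists>e>0. \<forall>y\<in>R \<inter> ball x e. v y \<le> v x + qtest q \<alpha> M b x y)"
proof -
  let ?u = "supconv R \<epsilon> v"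
  \<comment> \<open>Removing value and slope at \<open>\<xi>'\<close> leaves a semiconvex function
    squeezed between two paraboloids with vertex 0.\<close>
  define G where "G = (\<lambda>h. ?u (\<xi>' + h) - ?u \<xi>' - p \<bullet> h)"
  define C' where "C' = max C (1 / (2 * \<epsilon>))"
  note lower = supconv_lower_paraboloid[OF R v \<epsilon>]
  have C': "C' \<ge> 0" using \<epsilon> by (simp add: C'_def le_max_iff_disj)
  have bd: "\<bar>G h\<bar> \<le> C' * (norm h)\<^sup>2" for h
  proof -
    have "C \<le> C'" "1 / (2 * \<epsilon>) \<le> C'" by (auto simp: C'_def)
    from this[THEN mult_right_mono, of "(norm h)\<^sup>2"]
    have "C * (norm h)\<^sup>2 \<le> C' * (norm h)\<^sup>2" "(norm h)\<^sup>2 / (2 * \<epsilon>) \<le> C' * (norm h)\<^sup>2"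
      by auto
    then show ?thesis
      using upper[of h] lower[OF x', of h] unfolding G_def p[symmetric] by (simp add: abs_le_iff)
  qed
  have cvx: "convex_on UNIV (\<lambda>h. G h + 1 / (2 * \<epsilon>) * (norm h)\<^sup>2)"
  proof (rule convex_onI)
    fix t :: real and a b :: "real^'n" assume t: "0 < t" "t < 1"
    let ?H = "\<lambda>\<xi>. ?u \<xi> + (norm \<xi>)\<^sup>2 / (2 * \<epsilon>)"
    \<comment> \<open>Subtracting the affine function \<open>?A\<close> from the convex function
      \<open>?H\<close> preserves convexity.\<close>
    let ?A = "\<lambda>h. ?u \<xi>' + p \<bullet> h + (norm \<xi>')\<^sup>2 / (2 * \<epsilon>) + (\<xi>' \<bullet> h) / \<epsilon>"
    have eq: "G h + 1 / (2 * \<epsilon>) * (norm h)\<^sup>2 = ?H (\<xi>' + h) - ?A h" for h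
      using \<epsilon> by (simp add: G_def power2_norm_eq_inner inner_simps inner_commute field_simps)
    let ?c = "(1 - t) *\<^sub>R a + t *\<^sub>R b"
    have "?H ((1 - t) *\<^sub>R (\<xi>' + a) + t *\<^sub>R (\<xi>' + b)) \<le> (1 - t) * ?H (\<xi>' + a) + t * ?H (\<xi>' + b)"
      using convex_onD[OF convex_on_supconv[OF R v \<epsilon>], of t] t by simp
    moreover have "(1 - t) *\<^sub>R (\<xi>' + a) + t *\<^sub>R (\<xi>' + b) = \<xi>' + ?c"
      by (simp add: algebra_simps)
    moreover have "?A ?c = (1 - t) * ?A a + t * ?A b"
      using \<epsilon> by (simp add: inner_simps field_simps)
    ultimately show "G ?c + 1 / (2 * \<epsilon>) * (norm ?c)\<^sup>2
        \<le> (1 - t) * (G a + 1 / (2 * \<epsilon>) * (norm a)\<^sup>2) + t * (G b + 1 / (2 * \<epsilon>) * (norm b)\<^sup>2)"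
      unfolding eq by (simp add: algebra_simps)
  qed simp
  have m: "1 / (2 * \<epsilon>) \<ge> 0" using \<epsilon> by simp
  obtain K where K: "\<And>t. 0 < t \<Longrightarrow> t \<le> 1 \<Longrightarrow>
    \<exists>h w \<alpha> M. norm h \<le> K * t \<and> norm w \<le> K * t \<and> \<bar>\<alpha>\<bar> \<le> K \<and> \<bar>M\<bar> \<le> K \<and>
      \<alpha> * (b \<bullet> b)\<^sup>2 + 2 * M * (b \<bullet> b) \<le> (G (t *\<^sub>R b) + G (- t *\<^sub>R b)) / t\<^sup>2 + \<eta> \<and>
      (\<exists>e>0. \<forall>y\<in>ball h e. G y \<le> G h + qtest w \<alpha> M b h y)"
    using exists_directional_touching[OF cvx m bd C' \<eta>, of b] by metis
  have "\<exists>x q \<alpha> M. x \<in> R \<and> norm (x - x') \<le> (K * (1 + \<epsilon>)) * t \<and> norm (q - p) \<le> (K * (1 + \<epsilon>)) * t \<and>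
      \<bar>\<alpha>\<bar> \<le> K * (1 + \<epsilon>) \<and> \<bar>M\<bar> \<le> K * (1 + \<epsilon>) \<and>
      \<alpha> * (b \<bullet> b)\<^sup>2 + 2 * M * (b \<bullet> b) \<le> (?u (\<xi>' + t *\<^sub>R b) + ?u (\<xi>' - t *\<^sub>R b) - 2 * ?u \<xi>') / t\<^sup>2 + \<eta> \<and>
      (\<exists>e>0. \<forall>y\<in>R \<inter> ball x e. v y \<le> v x + qtest q \<alpha> M b x y)" if t: "0 < t" "t \<le> 1" for t
  proof -
    obtain h w \<alpha> M e where hw: "norm h \<le> K * t" "norm w \<le> K * t" "\<bar>\<alpha>\<bar> \<le> K" "\<bar>M\<bar> \<le> K"
      and S: "\<alpha> * (b \<bullet> b)\<^sup>2 + 2 * M * (b \<bullet> b) \<le> (G (t *\<^sub>R b) + G (- t *\<^sub>R b)) / t\<^sup>2 + \<eta>"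
      and e: "e > 0" "\<And>y. y \<in> ball h e \<Longrightarrow> G y \<le> G h + qtest w \<alpha> M b h y"
      using K[OF t] by blast
    have K0: "K \<ge> 0" using hw(3) by linarith
    have KK: "K \<le> K * (1 + \<epsilon>)" using K0 \<epsilon> by (simp add: algebra_simps)
    define \<xi> where "\<xi> = \<xi>' + h"
    define q where "q = p + w"
    obtain x where x: "x \<in> R" "?u \<xi> = v x - (norm (x - \<xi>))\<^sup>2 / (2 * \<epsilon>)"
      using supconv_attained[OF R v \<epsilon>] by blast
    have touch: "?u (\<xi> + k) \<le> ?u \<xi> + qtest q \<alpha> M b 0 k" if "norm k < e" for k
    proof -
      have "h + k \<in> ball h e" using that by (simp add: dist_norm)
      from e(2)[OF this] show ?thesis
        by (simp add: G_def \<xi>_def q_def qtest_def inner_simps add.assoc)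
    qed
    \<comment> \<open>The sup-convolution has slope \<open>(x - \<xi>) /\<^sub>R \<epsilon>\<close>
      from below and slope \<open>q\<close> from above at \<xi>.\<close>
    have "(x - \<xi>) /\<^sub>R \<epsilon> - q = 0"
    proof (rule zero_if_inner_le_square[OF e(1)])
      fix k :: "real^'n" assume k: "norm k < e"
      show "((x - \<xi>) /\<^sub>R \<epsilon> - q) \<bullet> k \<le> (\<bar>\<alpha>\<bar> * (norm b)\<^sup>2 + \<bar>M\<bar> + 1 / (2 * \<epsilon>)) * (norm k)\<^sup>2"
        using touch[OF k] lower[OF x, of k] qtest_le[of q \<alpha> M b 0 k]
        by (simp add: inner_diff_left algebra_simps)
    qed
    then have "q = (x - \<xi>) /\<^sub>R \<epsilon>" by simp
    then have xq: "x = \<xi> + \<epsilon> *\<^sub>R q" using \<epsilon> by simp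
    have x'p: "x' = \<xi>' + \<epsilon> *\<^sub>R p" using \<epsilon> by (simp add: p)
    show ?thesis
    proof (rule exI[of _ x], rule exI[of _ q], rule exI[of _ \<alpha>], rule exI[of _ M], intro conjI)
      show "x \<in> R" by fact
      have "x - x' = h + \<epsilon> *\<^sub>R w" unfolding xq x'p by (simp add: \<xi>_def q_def algebra_simps)
      then have "norm (x - x') \<le> norm h + \<epsilon> * norm w"
        using norm_triangle_ineq[of h "\<epsilon> *\<^sub>R w"] \<epsilon> by simp
      also have "\<dots> \<le> K * t + \<epsilon> * (K * t)" using hw \<epsilon> by (intro add_mono mult_left_mono) auto
      finally show "norm (x - x') \<le> (K * (1 + \<epsilon>)) * t" by (simp add: algebra_simps)
      show "norm (q - p) \<le> (K * (1 + \<epsilon>)) * t"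
        using hw(2) mult_right_mono[OF KK, of t] t by (simp add: q_def)
      show "\<bar>\<alpha>\<bar> \<le> K * (1 + \<epsilon>)" "\<bar>M\<bar> \<le> K * (1 + \<epsilon>)" using hw KK by auto
      show "\<alpha> * (b \<bullet> b)\<^sup>2 + 2 * M * (b \<bullet> b) \<le> (?u (\<xi>' + t *\<^sub>R b) + ?u (\<xi>' - t *\<^sub>R b) - 2 * ?u \<xi>') / t\<^sup>2 + \<eta>"
        using S by (simp add: G_def)
      have "v y \<le> v x + qtest q \<alpha> M b x y" if y: "y \<in> R \<inter> ball x e" for y
      proof -
        \<comment> \<open>Moving \<xi> along with \<open>y\<close> keeps the penalty equal to that
          of \<open>x\<close> at \<xi>, so the penalties cancel.\<close>
        have "v y - (norm (y - (\<xi> + (y - x))))\<^sup>2 / (2 * \<epsilon>) \<le> ?u (\<xi> + (y - x))"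
          using y by (intro supconv_upper[OF R v \<epsilon>]) auto
        also have "\<dots> \<le> ?u \<xi> + qtest q \<alpha> M b 0 (y - x)"
          using y by (intro touch) (simp add: dist_norm norm_minus_commute)
        finally show ?thesis
          unfolding x(2) by (simp add: qtest_def algebra_simps)
      qed
      then show "\<exists>e>0. \<forall>y\<in>R \<inter> ball x e. v y \<le> v x + qtest q \<alpha> M b x y"
        using e(1) by blast
    qed
  qed
  then show ?thesis using that by blast
qed

text \<open>The maps \<open>\<beta>\<close> and \<open>\<gamma>\<close> stand for the direction \<open>B\<close> and for \<open>h - c\<close>, so that the subsolution and the
  supersolution property (applied to \<open>- u\<close>) are treated at once.\<close>

lemma supconv_second_difference_ge:
  fixes R :: "(real^'n) set" and \<beta> :: "(real^'n) \<times> (real^'n) \<Rightarrow> real^'n" and \<gamma> :: "(real^'n) \<times> (real^'n) \<Rightarrow> real"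
  assumes R: "compact R" and v: "continuous_on R v" and \<epsilon>: "\<epsilon> > 0"
    and x': "x' \<in> interior R" "supconv R \<epsilon> v \<xi>' = v x' - (norm (x' - \<xi>'))\<^sup>2 / (2 * \<epsilon>)"
    and p: "p = (x' - \<xi>') /\<^sub>R \<epsilon>"
    and upper: "\<And>h. supconv R \<epsilon> v (\<xi>' + h) \<le> supconv R \<epsilon> v \<xi>' + p \<bullet> h + C * (norm h)\<^sup>2"
    and cont: "continuous_on (interior R \<times> UNIV) \<beta>" "continuous_on (interior R \<times> UNIV) \<gamma>"
    and b: "b = \<beta> (x', p)"
    and visc: "\<And>x q \<alpha> M e. \<lbrakk>x \<in> interior R; e > 0; \<forall>y\<in>R \<inter> ball x e. v y \<le> v x + qtest q \<alpha> M b x y\<rbrakk>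
       \<Longrightarrow> \<gamma> (x, q) \<le> \<alpha> * (\<beta> (x, q) \<bullet> b)\<^sup>2 + 2 * M * (\<beta> (x, q) \<bullet> \<beta> (x, q))"
    and \<eta>: "\<eta> > 0"
  shows "\<exists>t0>0. \<forall>t. 0 < t \<and> t < t0 \<longrightarrow> \<gamma> (x', p) \<le>
    (supconv R \<epsilon> v (\<xi>' + t *\<^sub>R b) + supconv R \<epsilon> v (\<xi>' - t *\<^sub>R b) - 2 * supconv R \<epsilon> v \<xi>') / t\<^sup>2 + \<eta>"
proof -
  let ?u = "supconv R \<epsilon> v"
  have x'R: "x' \<in> R" "R \<noteq> {}" using x'(1) interior_subset by auto
  obtain K where K: "\<And>t. 0 < t \<Longrightarrow> t \<le> 1 \<Longrightarrow>
    \<exists>x q \<alpha> M. x \<in> R \<and> norm (x - x') \<le> K * t \<and> norm (q - p) \<le> K * t \<and> \<bar>\<alpha>\<bar> \<le> K \<and> \<bar>M\<bar> \<le> K \<and>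
      \<alpha> * (b \<bullet> b)\<^sup>2 + 2 * M * (b \<bullet> b) \<le> (?u (\<xi>' + t *\<^sub>R b) + ?u (\<xi>' - t *\<^sub>R b) - 2 * ?u \<xi>') / t\<^sup>2 + \<eta>/2 \<and>
      (\<exists>e>0. \<forall>y\<in>R \<inter> ball x e. v y \<le> v x + qtest q \<alpha> M b x y)"
    using supconv_jets[OF R x'R(2) v \<epsilon> x'R(1) x'(2) p upper half_gt_zero[OF \<eta>], of b] by metis
  have K0: "K \<ge> 0" using K[of 1] by fastforce
  \<comment> \<open>The continuity errors add up to \<open>(1 + 3 * K) * \<omega>\<close>: \<omega>
    from \<gamma>, \<open>K * \<omega>\<close> from the \<alpha> term and
    \<open>2 * K * \<omega>\<close> from the \<open>M\<close> term. They use the half of \<eta> left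
    over by the touching argument.\<close>
  define \<omega> where "\<omega> = \<eta> / (2 * (1 + 3 * K))"
  have \<omega>: "\<omega> > 0" "(1 + 3 * K) * \<omega> = \<eta> / 2" using \<eta> K0 by (auto simp: \<omega>_def field_simps)
  \<comment> \<open>Measures the three errors of replacing \<open>(x', p)\<close> by
    \<open>z\<close> at once; it vanishes at \<open>(x', p)\<close> because
    \<open>b = \<beta> (x', p)\<close>.\<close>
  define W where "W = (\<lambda>z. norm ((\<gamma> z - \<gamma> (x', p), ((\<beta> z \<bullet> b)\<^sup>2 - (b \<bullet> b)\<^sup>2, \<beta> z \<bullet> \<beta> z - b \<bullet> b))))"
  have op: "open (interior R \<times> (UNIV :: (real^'n) set))" by (intro open_Times) auto
  have "continuous_on (interior R \<times> UNIV) W"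
    unfolding W_def by (intro continuous_intros cont)
  then have "continuous (at (x', p)) W"
    using op x'(1) by (simp add: continuous_on_eq_continuous_at)
  then have "\<forall>\<^sub>F z in at (x', p). W z < \<omega>"
    unfolding continuous_at by (rule order_tendstoD) (use \<omega> in \<open>simp add: W_def b\<close>)
  then obtain d1 where d1: "d1 > 0" "\<And>z. dist z (x', p) < d1 \<Longrightarrow> z \<noteq> (x', p) \<Longrightarrow> W z < \<omega>"
    unfolding eventually_at by blast
  have d1': "W z < \<omega>" if "dist z (x', p) < d1" for z
    using d1(2)[OF that] \<omega>(1) by (cases "z = (x', p)") (auto simp: W_def b)
  obtain d2 where d2: "d2 > 0" "ball x' d2 \<subseteq> interior R"
    using x'(1) open_interior open_contains_ball by blast
  \<comment> \<open>Keeps \<open>K * t\<close> below half of \<open>min d1 d2\<close>, so that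
    \<open>x\<close> stays interior and \<open>(x, q)\<close> lies within \<open>d1\<close> of
    \<open>(x', p)\<close>.\<close>
  define t0 where "t0 = min 1 (min d1 d2 / (2 * (K + 1)))"
  have t0: "t0 > 0" using d1 d2 K0 by (simp add: t0_def)
  show ?thesis
  proof (intro exI[of _ t0] conjI allI impI t0)
    fix t assume "0 < t \<and> t < t0"
    then have t: "0 < t" "t \<le> 1" "t < min d1 d2 / (2 * (K + 1))" by (auto simp: t0_def)
    have "K * t \<le> (K + 1) * t" using t by (simp add: algebra_simps)
    also have "\<dots> < min d1 d2 / 2" using t(3) K0 by (simp add: field_simps)
    finally have Kt: "K * t < min d1 d2 / 2" .
    obtain x q \<alpha> M e where x: "x \<in> R" "norm (x - x') \<le> K * t" "norm (q - p) \<le> K * t" and \<alpha>: "\<bar>\<alpha>\<bar> \<le> K" "\<bar>M\<bar> \<le> K"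
      and S: "\<alpha> * (b \<bullet> b)\<^sup>2 + 2 * M * (b \<bullet> b) \<le> (?u (\<xi>' + t *\<^sub>R b) + ?u (\<xi>' - t *\<^sub>R b) - 2 * ?u \<xi>') / t\<^sup>2 + \<eta>/2"
      and e: "e > 0" "\<forall>y\<in>R \<inter> ball x e. v y \<le> v x + qtest q \<alpha> M b x y"
      using K[OF t(1,2)] by blast
    have "x \<in> interior R"
      using x(2) Kt d2 by (intro subsetD[OF d2(2)]) (auto simp: dist_norm norm_minus_commute min_def split: if_splits)
    then have le: "\<gamma> (x, q) \<le> \<alpha> * (\<beta> (x, q) \<bullet> b)\<^sup>2 + 2 * M * (\<beta> (x, q) \<bullet> \<beta> (x, q))"
      using e by (rule visc)
    have "dist (x, q) (x', p) \<le> dist x x' + dist q p"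
      by (simp add: dist_Pair_Pair sqrt_sum_squares_le_sum)
    also have "\<dots> < d1" using x Kt by (simp add: dist_norm min_def split: if_splits)
    finally have W: "W (x, q) < \<omega>" by (rule d1')
    have W1: "\<bar>\<gamma> (x, q) - \<gamma> (x', p)\<bar> \<le> \<omega>"
      using norm_fst_le[of "\<gamma> (x, q) - \<gamma> (x', p)" "((\<beta> (x, q) \<bullet> b)\<^sup>2 - (b \<bullet> b)\<^sup>2, \<beta> (x, q) \<bullet> \<beta> (x, q) - b \<bullet> b)"] W
      unfolding W_def by simp
    have W2: "norm ((\<beta> (x, q) \<bullet> b)\<^sup>2 - (b \<bullet> b)\<^sup>2, \<beta> (x, q) \<bullet> \<beta> (x, q) - b \<bullet> b) \<le> \<omega>"
      using norm_snd_le[of "((\<beta> (x, q) \<bullet> b)\<^sup>2 - (b \<bullet> b)\<^sup>2, \<beta> (x, q) \<bullet> \<beta> (x, q) - b \<bullet> b)" "\<gamma> (x, q) - \<gamma> (x', p)"] W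
      unfolding W_def by simp
    have W3: "\<bar>(\<beta> (x, q) \<bullet> b)\<^sup>2 - (b \<bullet> b)\<^sup>2\<bar> \<le> \<omega>"
      using order_trans[OF norm_fst_le W2] by simp
    have W4: "\<bar>\<beta> (x, q) \<bullet> \<beta> (x, q) - b \<bullet> b\<bar> \<le> \<omega>"
      using order_trans[OF norm_snd_le W2] by simp
    have "\<bar>\<alpha> * ((\<beta> (x, q) \<bullet> b)\<^sup>2 - (b \<bullet> b)\<^sup>2)\<bar> \<le> K * \<omega>"
      unfolding abs_mult using \<alpha> W3 K0 by (intro mult_mono) auto
    moreover have "\<bar>M * (\<beta> (x, q) \<bullet> \<beta> (x, q) - b \<bullet> b)\<bar> \<le> K * \<omega>"
      unfolding abs_mult using \<alpha> W4 K0 by (intro mult_mono) auto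
    ultimately have "\<alpha> * (\<beta> (x, q) \<bullet> b)\<^sup>2 + 2 * M * (\<beta> (x, q) \<bullet> \<beta> (x, q))
       \<le> \<alpha> * (b \<bullet> b)\<^sup>2 + 2 * M * (b \<bullet> b) + 3 * (K * \<omega>)"
      by (simp add: abs_le_iff right_diff_distrib)
    then show "\<gamma> (x', p) \<le> (?u (\<xi>' + t *\<^sub>R b) + ?u (\<xi>' - t *\<^sub>R b) - 2 * ?u \<xi>') / t\<^sup>2 + \<eta>"
      using le S W1 \<omega>(2) by (simp add: abs_le_iff algebra_simps)
  qed
qed

section \<open>Local Lipschitz continuity of Sobolev functions\<close>

text \<open>The exponent \<open>m\<close> makes the family closed under differentiation up to linear
  combinations, so smoothness follows by induction.\<close>

definition flat :: "nat \<Rightarrow> real \<Rightarrow> real" where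
  "flat m t = (if t > 0 then exp (- inverse t) * inverse t ^ m else 0)"

lemma flat_nonneg: "flat m t \<ge> 0"
  by (simp add: flat_def)

text \<open>The bound \<open>(1 + x / n) ^ n \<le> exp x\<close> with \<open>n = m + 2\<close> and
  \<open>x = inverse t\<close>: dividing \<open>t ^ n\<close> by \<open>t ^ m\<close> leaves the
  square that gives differentiability at 0.\<close>

lemma flat_le_square: "flat m t \<le> real (m + 2) ^ (m + 2) * t\<^sup>2"
proof (cases "t > 0")
  case True
  define n where "n = m + 2"
  have n: "n > 0" by (simp add: n_def)
  have "(inverse t / real n) ^ n \<le> (1 + inverse t / real n) ^ n"
    using True by (intro power_mono) auto
  also have "\<dots> \<le> exp (inverse t)"
    using exp_ge_one_plus_x_over_n_power_n[of n "inverse t"] True n by (simp add: order_trans[of _ 0])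
  finally have "exp (- inverse t) \<le> inverse ((inverse t / real n) ^ n)"
    unfolding exp_minus using True n by (intro le_imp_inverse_le) auto
  also have "\<dots> = real n ^ n * t ^ n"
    using True by (simp add: power_inverse[symmetric] power_mult_distrib[symmetric] divide_inverse mult.commute)
  finally have "flat m t \<le> real n ^ n * (t ^ n * inverse t ^ m)"
    using True by (simp add: flat_def)
  also have "t ^ n * inverse t ^ m = t\<^sup>2"
    using True by (simp add: n_def power_add power_inverse power2_eq_square field_simps)
  finally show ?thesis by (simp add: n_def)
qed (simp add: flat_def)

lemma DERIV_flat: "DERIV (flat m) t :> flat (m + 2) t - real m * flat (m + 1) t"
proof -
  consider "t > 0" | "t < 0" | "t = 0" by linarith
  then show ?thesis
  proof cases
    case 1
    have *: "x * x ^ (k - Suc 0) = (if k = 0 then x else x ^ k)" for x :: real and k by (cases k) auto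
    have "((\<lambda>t. exp (- inverse t) * inverse t ^ m) has_field_derivative
        flat (m + 2) t - real m * flat (m + 1) t) (at t)"
      using 1 by (cases m) (auto intro!: derivative_eq_intros simp: flat_def power2_eq_square algebra_simps *)
    then show ?thesis
      by (rule has_field_derivative_transform_within_open[where S = "{0<..}"]) (use 1 in \<open>auto simp: flat_def\<close>)
  next
    case 2
    have "((\<lambda>t. 0) has_field_derivative flat (m + 2) t - real m * flat (m + 1) t) (at t)"
      using 2 by (auto simp: flat_def)
    then show ?thesis
      by (rule has_field_derivative_transform_within_open[where S = "{..<0}"]) (use 2 in \<open>auto simp: flat_def\<close>)
  next
    case 3
    have "((\<lambda>y. (flat m y - flat m 0) / (y - 0)) \<longlongrightarrow> 0) (at 0)"
    proof (rule Lim_null_comparison)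
      show "\<forall>\<^sub>F y in at 0. norm ((flat m y - flat m 0) / (y - 0)) \<le> real (m + 2) ^ (m + 2) * \<bar>y\<bar>"
      proof (rule always_eventually, rule allI)
        fix y :: real
        have "\<bar>flat m y\<bar> \<le> real (m + 2) ^ (m + 2) * (\<bar>y\<bar> * \<bar>y\<bar>)"
          using flat_le_square[of m y] flat_nonneg[of m y] by (simp add: power2_eq_square)
        then show "norm ((flat m y - flat m 0) / (y - 0)) \<le> real (m + 2) ^ (m + 2) * \<bar>y\<bar>"
          by (cases "y = 0") (simp_all add: flat_def[of m 0] field_simps)
      qed
      show "((\<lambda>y::real. real (m + 2) ^ (m + 2) * \<bar>y\<bar>) \<longlongrightarrow> 0) (at 0)"
        by (auto intro!: tendsto_eq_intros)
    qed
    then show ?thesis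
      unfolding 3 by (simp add: has_field_derivative_iff flat_def[of _ 0])
  qed
qed

lemma continuous_on_flat [continuous_intros]:
  "continuous_on S f \<Longrightarrow> continuous_on S (\<lambda>x. flat m (f x))"
  by (rule continuous_on_compose2[of UNIV "flat m"])
    (auto intro!: continuous_at_imp_continuous_on DERIV_isCont DERIV_flat)

section \<open>C^k functions on the whole space and bump functions\<close>

lemma pderiv_iI: "(f has_derivative f') (at x) \<Longrightarrow> pderiv_i f i x = f' (axis i 1)"
  by (simp add: pderiv_i_def frechet_derivative_at[symmetric])

lemma Ck_on_Suc_imp: "Ck_on (Suc k) U f \<Longrightarrow> Ck_on k U f"
  by (induction k arbitrary: f) auto

lemma Ck_on_UNIV_const: "Ck_on k UNIV (\<lambda>x :: real^'n. c)"
proof (induction k arbitrary: c)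
  case (Suc k)
  have "pderiv_i (\<lambda>x :: real^'n. c) i = (\<lambda>x. 0)" for i :: 'n
    by (rule ext) (rule pderiv_iI[OF has_derivative_const])
  with Suc show ?case by simp
qed simp

lemma Ck_on_UNIV_add: "Ck_on k UNIV f \<Longrightarrow> Ck_on k UNIV g \<Longrightarrow> Ck_on k UNIV (\<lambda>x. f x + g x)"
proof (induction k arbitrary: f g)
  case (Suc k)
  have "pderiv_i (\<lambda>x. f x + g x) i = (\<lambda>x. pderiv_i f i x + pderiv_i g i x)" for i
  proof
    fix x
    have "(f has_derivative frechet_derivative f (at x)) (at x)" "(g has_derivative frechet_derivative g (at x)) (at x)"
      using Suc.prems by (auto simp: frechet_derivative_works[symmetric])
    from pderiv_iI[OF has_derivative_add[OF this]]
    show "pderiv_i (\<lambda>x. f x + g x) i x = pderiv_i f i x + pderiv_i g i x"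
      by (simp add: pderiv_i_def)
  qed
  with Suc show ?case by (auto intro: continuous_on_add)
qed (auto intro: continuous_on_add)

lemma Ck_on_UNIV_mult: "Ck_on k UNIV f \<Longrightarrow> Ck_on k UNIV g \<Longrightarrow> Ck_on k UNIV (\<lambda>x. f x * g x)"
proof (induction k arbitrary: f g)
  case (Suc k)
  have "pderiv_i (\<lambda>x. f x * g x) i = (\<lambda>x. f x * pderiv_i g i x + pderiv_i f i x * g x)" for i
  proof
    fix x
    have "(f has_derivative frechet_derivative f (at x)) (at x)" "(g has_derivative frechet_derivative g (at x)) (at x)"
      using Suc.prems by (auto simp: frechet_derivative_works[symmetric])
    from pderiv_iI[OF has_derivative_mult[OF this]]
    show "pderiv_i (\<lambda>x. f x * g x) i x = f x * pderiv_i g i x + pderiv_i f i x * g x"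
      by (simp add: pderiv_i_def)
  qed
  moreover have "Ck_on k UNIV (\<lambda>x. f x * pderiv_i g i x + pderiv_i f i x * g x)" for i
    using Suc.prems by (intro Ck_on_UNIV_add Suc.IH Ck_on_Suc_imp[of k _ f] Ck_on_Suc_imp[of k _ g]) auto
  ultimately show ?case using Suc.prems by (auto intro: continuous_on_mult)
qed (auto intro: continuous_on_mult)

lemma Ck_on_UNIV_component: "Ck_on k UNIV (\<lambda>x. c * (x - z) $ i)"
proof (cases k)
  case (Suc j)
  have d: "((\<lambda>x. c * (x - z) $ i) has_derivative (\<lambda>h. c * h $ i)) (at x)" for x
    by (auto intro!: derivative_eq_intros bounded_linear.has_derivative[OF bounded_linear_vec_nth])
  have "pderiv_i (\<lambda>x. c * (x - z) $ i) j = (\<lambda>x. c * axis j 1 $ i)" for j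
    by (rule ext) (rule pderiv_iI[OF d])
  then show ?thesis
    using d by (auto simp: Suc differentiable_def Ck_on_UNIV_const intro!: continuous_intros)
qed (auto intro!: continuous_intros)

text \<open>A radial function that is positive exactly on the open ball of radius \<delta> when
  \<delta> is positive. Mollification uses \<open>bump 0\<close>; the other indices arise from its
  derivatives.\<close>

definition bump :: "nat \<Rightarrow> real \<Rightarrow> real^'n \<Rightarrow> real^'n \<Rightarrow> real" where
  "bump m \<delta> z x = flat m (\<delta>\<^sup>2 - (x - z) \<bullet> (x - z))"

lemma has_derivative_bump:
  "(bump m \<delta> z has_derivative
     (\<lambda>h. (bump (m + 2) \<delta> z x - real m * bump (m + 1) \<delta> z x) * (- 2 * ((x - z) \<bullet> h)))) (at x)"
proof -
  have 1: "((\<lambda>x. \<delta>\<^sup>2 - (x - z) \<bullet> (x - z)) has_derivative (\<lambda>h. - 2 * ((x - z) \<bullet> h))) (at x)"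
    by (auto intro!: derivative_eq_intros simp: fun_eq_iff inner_commute)
  show ?thesis
    using has_derivative_compose[OF 1 DERIV_flat[unfolded has_field_derivative_def], of m]
    unfolding bump_def[abs_def] .
qed

lemma continuous_on_bump [continuous_intros]:
  "continuous_on S f \<Longrightarrow> continuous_on S g \<Longrightarrow> continuous_on S (\<lambda>x. bump m \<delta> (f x) (g x))"
  unfolding bump_def by (intro continuous_intros)

text \<open>Written with sums and products only, so that the closure rules for \<open>Ck_on\<close>
  apply directly.\<close>

lemma pderiv_i_bump:
  "pderiv_i (bump m \<delta> z) i =
    (\<lambda>x. (bump (m + 2) \<delta> z x + - real m * bump (m + 1) \<delta> z x) * (- 2 * (x - z) $ i))"
  by (rule ext) (simp add: pderiv_iI[OF has_derivative_bump] inner_axis)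

lemma Ck_on_bump: "Ck_on k UNIV (bump m \<delta> z)"
proof (induction k arbitrary: m)
  case (Suc k)
  have "Ck_on k UNIV (pderiv_i (bump m \<delta> z) i)" for i
    unfolding pderiv_i_bump
    by (intro Ck_on_UNIV_add Ck_on_UNIV_mult Ck_on_UNIV_const Ck_on_UNIV_component Suc.IH)
  moreover have "bump m \<delta> z differentiable at x" for x
    using has_derivative_bump unfolding differentiable_def by blast
  ultimately show ?case by (auto intro!: continuous_intros)
qed (auto intro!: continuous_intros)

lemma bump_nonneg: "bump m \<delta> z x \<ge> 0"
  by (simp add: bump_def flat_nonneg)

lemma bump_eq_0:
  assumes "\<delta> \<ge> 0" "cball z \<delta> \<subseteq> S" "x \<notin> S"
  shows "bump m \<delta> z x = 0"
proof -
  have "\<delta> < norm (x - z)" using assms(2,3) by (force simp: dist_norm norm_minus_commute)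
  then have "\<delta>\<^sup>2 \<le> (norm (x - z))\<^sup>2" using assms(1) by (intro power_mono) auto
  then show ?thesis by (simp add: bump_def flat_def power2_norm_eq_inner)
qed

lemma bump_shift: "bump m \<delta> z x = bump m \<delta> 0 (x - z)"
  by (simp add: bump_def)

lemma test_fun_bump:
  assumes "\<delta> \<ge> 0" "cball z \<delta> \<subseteq> \<Omega>"
  shows "test_fun \<Omega> (bump m \<delta> z)"
proof -
  have "{x. bump m \<delta> z x \<noteq> 0} \<subseteq> cball z \<delta>"
    using bump_eq_0[OF assms(1) order_refl] by blast
  then have sub: "closure {x. bump m \<delta> z x \<noteq> 0} \<subseteq> cball z \<delta>"
    by (intro closure_minimal closed_cball)
  moreover have "compact (closure {x. bump m \<delta> z x \<noteq> 0})"
    using sub by (meson bounded_cball bounded_subset closed_closure compact_eq_bounded_closed)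
  ultimately show ?thesis
    using assms Ck_on_bump by (auto simp: test_fun_def smooth_on_def)
qed

text \<open>By translation invariance, the normalising constant is the same for every
  centre.\<close>

lemma integral_bump:
  fixes z :: "real^'n"
  assumes "\<delta> \<ge> 0" "cball z \<delta> \<subseteq> cbox a b"
  shows "integral (cbox a b) (bump m \<delta> z) = (LINT x|lborel. bump m \<delta> (0 :: real^'n) x)"
proof -
  have "set_integrable lborel (cbox a b) (bump m \<delta> z)"
    unfolding set_integrable_def by (intro borel_integrable_compact compact_cbox continuous_intros)
  then have "integral (cbox a b) (bump m \<delta> z) = (LINT x:cbox a b|lborel. bump m \<delta> z x)"
    by (simp add: set_borel_integral_eq_integral)
  also have "\<dots> = (LINT x|lborel. bump m \<delta> z x)"
    unfolding set_lebesgue_integral_def using bump_eq_0[OF assms]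
    by (intro Bochner_Integration.integral_cong) (auto simp: indicator_def)
  also have "\<dots> = (LINT x|lborel. bump m \<delta> 0 (- z + x))"
    by (subst bump_shift) simp
  also have "\<dots> = (LINT x|distr lborel borel ((+) (- z)). bump m \<delta> 0 x)"
    by (intro integral_distr[symmetric] borel_measurable_continuous_onI continuous_intros) auto
  also have "\<dots> = (LINT x|lborel. bump m \<delta> (0 :: real^'n) x)"
    by (simp add: lborel_distr_plus)
  finally show ?thesis .
qed

section \<open>Lipschitz bound from a bounded weak gradient\<close>

text \<open>Links the Lebesgue integral over \<Omega> in the weak gradient identity with the
  integral over a box, where differentiation under the integral sign is carried out.\<close>

lemma set_lebesgue_integral_eq_integral_cbox:
  fixes w :: "'a::euclidean_space \<Rightarrow> real"
  assumes "cbox a b \<subseteq> \<Omega>" "continuous_on (cbox a b) w" "\<And>x. x \<notin> cbox a b \<Longrightarrow> w x = 0"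
  shows "(LINT x:\<Omega>|lebesgue. w x) = integral (cbox a b) w"
proof -
  have "(LINT x:\<Omega>|lebesgue. w x) = (LINT x:cbox a b|lebesgue. w x)"
    unfolding set_lebesgue_integral_def using assms(1,3)
    by (intro Bochner_Integration.integral_cong) (auto simp: indicator_def)
  also have "\<dots> = integral (cbox a b) w"
    by (intro set_lebesgue_integral_eq_integral absolutely_integrable_continuous assms)
  finally show ?thesis .
qed

text \<open>Integration by parts moves the derivative onto \<open>u\<close>, whose weak gradient is
  at most \<open>M\<close> almost everywhere on the support of the nonnegative bump.\<close>

lemma weak_gradient_bump_bound:
  fixes u :: "real^'n \<Rightarrow> real" and G :: "real^'n \<Rightarrow> real^'n"
  assumes ab: "cbox a b \<subseteq> \<Omega>" and contu: "continuous_on (cbox a b) u"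
    and M: "AE x in lebesgue. x \<in> cbox a b \<longrightarrow> norm (G x) \<le> M" "M \<ge> 0"
    and Gweak: "\<And>\<phi>. test_fun \<Omega> \<phi> \<Longrightarrow>
      (LINT x:\<Omega>|lebesgue. u x * pderiv_i \<phi> i x) = - (LINT x:\<Omega>|lebesgue. G x $ i * \<phi> x)"
    and \<delta>: "\<delta> \<ge> 0" and z: "cball z \<delta> \<subseteq> cbox a b"
  shows "\<bar>integral (cbox a b) (\<lambda>x. u x * pderiv_i (bump 0 \<delta> z) i x)\<bar> \<le> M * integral (cbox a b) (bump 0 \<delta> z)"
proof -
  have "integral (cbox a b) (\<lambda>x. u x * pderiv_i (bump 0 \<delta> z) i x) = (LINT x:\<Omega>|lebesgue. u x * pderiv_i (bump 0 \<delta> z) i x)"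
    using bump_eq_0[OF \<delta> z]
    by (intro set_lebesgue_integral_eq_integral_cbox[symmetric] ab contu continuous_intros contu)
      (auto simp: pderiv_i_bump intro!: continuous_intros)
  also have "\<dots> = - (LINT x:\<Omega>|lebesgue. G x $ i * bump 0 \<delta> z x)"
    using \<delta> z ab by (intro Gweak test_fun_bump) auto
  also have "\<bar>\<dots>\<bar> \<le> M * integral (cbox a b) (bump 0 \<delta> z)"
  proof -
    let ?F = "\<lambda>x. indicator \<Omega> x *\<^sub>R (G x $ i * bump 0 \<delta> z x)"
    let ?g = "\<lambda>x. M * (indicator (cbox a b) x *\<^sub>R bump 0 \<delta> z x)"
    have abs_int: "bump 0 \<delta> z absolutely_integrable_on cbox a b"
      by (intro absolutely_integrable_continuous continuous_intros)
    then have g: "integrable lebesgue ?g"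
      unfolding set_integrable_def by (intro integrable_mult_right)
    have gI: "(LINT x|lebesgue. ?g x) = M * integral (cbox a b) (bump 0 \<delta> z)"
      using set_lebesgue_integral_eq_integral(2)[OF abs_int] by (simp add: set_lebesgue_integral_def)
    have le: "AE x in lebesgue. \<bar>?F x\<bar> \<le> ?g x"
      using M(1)
    proof (rule eventually_mono)
      fix x assume x: "x \<in> cbox a b \<longrightarrow> norm (G x) \<le> M"
      show "\<bar>?F x\<bar> \<le> ?g x"
      proof (cases "x \<in> cbox a b")
        case True
        then have "\<bar>G x $ i\<bar> * bump 0 \<delta> z x \<le> M * bump 0 \<delta> z x"
          using x component_le_norm_cart[of "G x" i] by (intro mult_right_mono bump_nonneg) auto
        then show ?thesis using True ab by (auto simp: abs_mult bump_nonneg)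
      next
        case False
        then show ?thesis using bump_eq_0[OF \<delta> z, of x] by auto
      qed
    qed
    have "\<bar>LINT x|lebesgue. ?F x\<bar> \<le> (LINT x|lebesgue. ?g x)"
    \<comment> \<open>A function that is not integrable has integral 0 by convention, and the bound
      holds in that case as well.\<close>
    proof (cases "integrable lebesgue ?F")
      case True
      then show ?thesis
        using integral_abs_bound[of lebesgue ?F] integral_mono_AE[OF integrable_abs[OF True] g le] by linarith
    next
      case False
      have "0 \<le> (LINT x|lebesgue. ?g x)"
        using M by (intro integral_nonneg_AE AE_I2) (simp add: bump_nonneg)
      then show ?thesis using False by (simp add: not_integrable_integral_eq)
    qed
    then show ?thesis unfolding gI by (simp add: set_lebesgue_integral_def)
  qed
  finally show ?thesis .
qed

text \<open>Mollification: along a segment the mollified function has derivative bounded through the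
  weak gradient, and it tends to \<open>u\<close> uniformly as the bump shrinks. The factor
  \<open>CARD('n)\<close> in the constant \<open>L\<close> comes from summing the bounds for the
  single partial derivatives.\<close>

lemma W1inf_loc_imp_lipschitz_near:
  fixes u :: "real^'n \<Rightarrow> real"
  assumes \<Omega>: "open \<Omega>" and W: "W1inf_loc \<Omega> u" and x0: "x0 \<in> \<Omega>"
  obtains r L where "r > 0" "L \<ge> 0" "cball x0 r \<subseteq> \<Omega>"
    "\<And>x y. x \<in> cball x0 r \<Longrightarrow> y \<in> cball x0 r \<Longrightarrow> \<bar>u x - u y\<bar> \<le> L * norm (x - y)"
proof -
  obtain a b where ab: "x0 \<in> box a b" "cbox a b \<subseteq> \<Omega>"
    using open_contains_cbox[of \<Omega> x0] \<Omega> x0 by metis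
  obtain e where e: "e > 0" "ball x0 e \<subseteq> box a b"
    using open_contains_ball open_box ab(1) by blast
  \<comment> \<open>Balls of radius at most \<open>r\<close> around points of
    \<open>cball x0 r\<close> then reach at most \<open>e / 2\<close> from
    \<open>x0\<close>.\<close>
  define r where "r = e / 4"
  have r: "r > 0" using e by (simp add: r_def)
  have cb: "cball y \<delta> \<subseteq> cbox a b" if "y \<in> cball x0 r" "\<delta> \<le> r" for y \<delta>
  proof
    fix x assume "x \<in> cball y \<delta>"
    then have "dist x0 x \<le> r + \<delta>" using that dist_triangle[of x0 x y] by simp
    also have "\<dots> < e" using that e by (simp add: r_def)
    finally show "x \<in> cbox a b" using subset_trans[OF e(2) box_subset_cbox] by auto
  qed
  have contu: "continuous_on (cbox a b) u"
    using W[unfolded W1inf_loc_def, THEN conjunct1] ab(2) by (rule continuous_on_subset)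
  from W[unfolded W1inf_loc_def, THEN conjunct2] obtain G :: "real^'n \<Rightarrow> real^'n"
    where Gbd: "\<forall>K. compact K \<and> K \<subseteq> \<Omega> \<longrightarrow> (\<exists>M. AE x in lebesgue. x \<in> K \<longrightarrow> norm (G x) \<le> M)"
      and Gweak: "\<forall>\<phi> i. test_fun \<Omega> \<phi> \<longrightarrow>
        (LINT x:\<Omega>|lebesgue. u x * pderiv_i \<phi> i x) = - (LINT x:\<Omega>|lebesgue. G x $ i * \<phi> x)"
    by (elim exE conjE) (rule that)
  obtain M0 where M0: "AE x in lebesgue. x \<in> cbox a b \<longrightarrow> norm (G x) \<le> M0"
    using Gbd[rule_format, of "cbox a b"] ab(2) compact_cbox by auto
  define M where "M = max M0 0"
  have M: "AE x in lebesgue. x \<in> cbox a b \<longrightarrow> norm (G x) \<le> M" "M \<ge> 0"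
    using M0 by (auto simp: M_def elim: eventually_mono)
  define L where "L = real CARD('n) * M"
  have L: "L \<ge> 0" using M by (simp add: L_def)

  have lip: "\<bar>u y1 - u y2\<bar> \<le> L * norm (y1 - y2)" if y: "y1 \<in> cball x0 r" "y2 \<in> cball x0 r" for y1 y2
  proof (rule field_le_epsilon)
    fix \<omega> :: real assume \<omega>: "\<omega> > 0"
    have "uniformly_continuous_on (cbox a b) u"
      by (rule compact_uniformly_continuous[OF contu compact_cbox])
    then obtain d where d: "d > 0" "\<And>x y. x \<in> cbox a b \<Longrightarrow> y \<in> cbox a b \<Longrightarrow> dist x y < d \<Longrightarrow> dist (u x) (u y) < \<omega> / 2"
      using half_gt_zero[OF \<omega>] by (rule uniformly_continuous_onE) (rule that; simp add: dist_commute)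
    define \<delta> where "\<delta> = min r (d / 2)"
    have \<delta>: "\<delta> > 0" "\<delta> \<le> r" "\<delta> < d" using r d by (auto simp: \<delta>_def)
    define c where "c = (LINT x|lborel. bump 0 \<delta> (0 :: real^'n) x)"
    have c: "integral (cbox a b) (bump 0 \<delta> z) = c" if "z \<in> cball x0 r" for z
      unfolding c_def using \<delta> by (intro integral_bump cb that) auto
    have bint: "bump 0 \<delta> z integrable_on cbox a b" for z
      by (intro integrable_continuous continuous_intros)
    have "c \<noteq> 0"
    proof
      assume "c = 0"
      then have int0: "(bump 0 \<delta> x0 has_integral 0) (cbox a b)"
        using integrable_integral[OF bint[of x0]] c[of x0] r by simp
      have "bump 0 \<delta> x0 x0 = 0"
        using ab(1) box_subset_cbox[of a b]
        by (intro has_integral_0_cbox_imp_0[OF _ bump_nonneg int0] continuous_intros) auto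
      then show False using \<delta> by (simp add: bump_def flat_def)
    qed
    moreover have "c \<ge> 0"
      unfolding c_def by (intro integral_nonneg_AE AE_I2) (simp add: bump_nonneg)
    ultimately have cpos: "c > 0" by simp
    \<comment> \<open>The mollification without normalisation: \<open>F y\<close> is close to
      \<open>u y * c\<close>.\<close>
    define F where "F = (\<lambda>y. integral (cbox a b) (\<lambda>x. u x * bump 0 \<delta> y x))"
    have Fu: "\<bar>F y - u y * c\<bar> \<le> \<omega> / 2 * c" if "y \<in> cball x0 r" for y
    proof -
      have yab: "y \<in> cbox a b" using cb[OF that \<delta>(2)] \<delta> by auto
      have "F y - u y * c = integral (cbox a b) (\<lambda>x. u x * bump 0 \<delta> y x - u y * bump 0 \<delta> y x)"
        unfolding F_def c[OF that, symmetric]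
        by (subst integral_diff) (auto intro!: integrable_continuous continuous_intros contu)
      also have "\<bar>\<dots>\<bar> \<le> integral (cbox a b) (\<lambda>x. \<omega> / 2 * bump 0 \<delta> y x)"
        unfolding real_norm_def[symmetric]
      proof (rule integral_norm_bound_integral)
        fix x assume x: "x \<in> cbox a b"
        show "norm (u x * bump 0 \<delta> y x - u y * bump 0 \<delta> y x) \<le> \<omega> / 2 * bump 0 \<delta> y x"
        proof (cases "x \<in> cball y \<delta>")
          case True
          then have "dist x y < d" using \<delta> by (simp add: dist_commute)
          then have "\<bar>u x - u y\<bar> \<le> \<omega> / 2" using d(2)[OF x yab] by (simp add: dist_real_def)
          then have "\<bar>u x - u y\<bar> * bump 0 \<delta> y x \<le> \<omega> / 2 * bump 0 \<delta> y x"
            by (intro mult_right_mono bump_nonneg)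
          then show ?thesis by (simp add: left_diff_distrib[symmetric] abs_mult bump_nonneg)
        next
          case False
          then show ?thesis using bump_eq_0[OF _ order_refl, of \<delta> x y 0] \<delta> by simp
        qed
      qed (auto intro!: integrable_continuous continuous_intros contu)
      also have "\<dots> = \<omega> / 2 * c" by (simp add: c[OF that])
      finally show ?thesis .
    qed
    define w where "w = y2 - y1"
    define z where "z = (\<lambda>t::real. y1 + t *\<^sub>R w)"
    have zc: "z t \<in> cball x0 r" if "t \<in> {0..1}" for t
    proof -
      have "z t = (1 - t) *\<^sub>R y1 + t *\<^sub>R y2" by (simp add: z_def w_def algebra_simps)
      then show ?thesis using convexD[OF convex_cball y, of "1 - t" t] that by auto
    qed
    \<comment> \<open>The derivative in \<open>t\<close> of the integrand; for \<open>m = 0\<close>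
      the derivative of \<open>bump\<close> involves \<open>bump 2\<close> alone.\<close>
    define F' where "F' = (\<lambda>t x. u x * (bump 2 \<delta> (z t) x * (2 * ((x - z t) \<bullet> w))))"
    have der: "((\<lambda>t. F (z t)) has_field_derivative integral (cbox a b) (F' t)) (at t within {0..1})"
      if t: "t \<in> {0..1}" for t
      unfolding F_def
    proof (rule leibniz_rule_field_derivative[OF _ _ _ t])
      fix t x
      have zd: "((\<lambda>t. x - z t) has_derivative (\<lambda>h. - (h *\<^sub>R w))) (at t within {0..1})"
        unfolding z_def by (auto intro!: derivative_eq_intros)
      have "((\<lambda>t. bump 0 \<delta> (z t) x) has_derivative (\<lambda>h. (bump 2 \<delta> (z t) x * (2 * ((x - z t) \<bullet> w))) * h)) (at t within {0..1})"
        using has_derivative_compose[OF zd has_derivative_bump[of 0 \<delta> 0]] by (simp add: bump_def mult_ac numeral_2_eq_2)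
      then have "((\<lambda>t. bump 0 \<delta> (z t) x) has_field_derivative (bump 2 \<delta> (z t) x * (2 * ((x - z t) \<bullet> w)))) (at t within {0..1})"
        by (simp add: has_field_derivative_def)
      then show "((\<lambda>t. u x * bump 0 \<delta> (z t) x) has_field_derivative F' t x) (at t within {0..1})"
        unfolding F'_def by (rule DERIV_cmult)
    next
      show "(\<lambda>x. u x * bump 0 \<delta> (z t) x) integrable_on cbox a b" for t
        by (intro integrable_continuous continuous_intros contu)
      have "continuous_on ({0..1::real} \<times> cbox a b) (\<lambda>p. u (snd p))"
        by (rule continuous_on_compose2[OF contu]) (auto intro!: continuous_intros)
      then show "continuous_on ({0..1} \<times> cbox a b) (\<lambda>(t, x). F' t x)"
        unfolding F'_def z_def split_beta by (intro continuous_intros)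
    qed simp
    have "norm (integral (cbox a b) (F' t)) \<le> L * norm w * c" if t: "t \<in> {0..1}" for t
    proof -
      let ?J = "\<lambda>i. integral (cbox a b) (\<lambda>x. u x * pderiv_i (bump 0 \<delta> (z t)) i x)"
      \<comment> \<open>Differentiating a bump in its centre is minus differentiating it in
        \<open>x\<close>, which brings in the partial derivatives bounded by the weak
        gradient.\<close>
      have "F' t = (\<lambda>x. \<Sum>i\<in>UNIV. - (w $ i) * (u x * pderiv_i (bump 0 \<delta> (z t)) i x))"
        by (rule ext) (auto simp: F'_def pderiv_i_bump inner_vec_def sum_distrib_left algebra_simps numeral_2_eq_2 intro!: sum.cong)
      then have "integral (cbox a b) (F' t) = (\<Sum>i\<in>UNIV. - (w $ i) * ?J i)"
        by (simp only:, subst integral_sum) (auto simp: pderiv_i_bump intro!: integrable_continuous continuous_intros contu)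
      also have "norm \<dots> \<le> (\<Sum>i\<in>(UNIV::'n set). norm w * (M * c))"
      proof (rule order_trans[OF norm_sum], rule sum_mono)
        fix i
        have "\<bar>?J i\<bar> \<le> M * c"
          using weak_gradient_bump_bound[OF ab(2) contu M Gweak[rule_format], of \<delta> "z t" i] \<delta> cb[OF zc[OF t] \<delta>(2)] c[OF zc[OF t]] by simp
        then show "norm (- (w $ i) * ?J i) \<le> norm w * (M * c)"
          using component_le_norm_cart[of w i] by (simp add: abs_mult mult_mono)
      qed
      also have "\<dots> = L * norm w * c" by (simp add: L_def)
      finally show ?thesis .
    qed
    from field_differentiable_bound[OF convex_real_interval(5) der this, of 0 1]
    have "\<bar>F y1 - F y2\<bar> \<le> L * norm w * c" by (simp add: z_def w_def)
    then have "\<bar>u y1 * c - u y2 * c\<bar> \<le> L * norm w * c + \<omega> * c"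
      using Fu[OF y(1)] Fu[OF y(2)] by linarith
    then have "\<bar>u y1 - u y2\<bar> * c \<le> (L * norm w + \<omega>) * c"
      using cpos by (simp add: left_diff_distrib[symmetric] distrib_right abs_mult)
    then show "\<bar>u y1 - u y2\<bar> \<le> L * norm (y1 - y2) + \<omega>"
      using cpos by (simp add: w_def norm_minus_commute)
  qed
  have "cball x0 r \<subseteq> \<Omega>" using cb[of x0 r] r ab by auto
  with r L lip that show ?thesis by blast
qed

section \<open>Doubling of variables\<close>

text \<open>Nonnegativity bounds the penalties by \<open>u x - u y\<close>, hence by
  \<open>L * s\<close> with \<open>s\<close> the length of the path from \<open>x\<close> over \<xi>
  and \<zeta> to \<open>y\<close>. The three quadratic penalties sum to at least
  \<open>s\<^sup>2 / (6 * \<epsilon>)\<close>, so \<open>s \<le> 6 * L * \<epsilon>\<close>.\<close>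

lemma doubling_estimates:
  fixes x y \<xi> \<zeta> x0 :: "'a::real_inner"
  assumes \<epsilon>: "\<epsilon> > 0" and L: "L \<ge> 0" and lip: "\<bar>u x - u y\<bar> \<le> L * norm (x - y)" and \<mu>: "\<mu> \<ge> 0"
    and ge: "0 \<le> u x - (norm (x - \<xi>))\<^sup>2 / (2 * \<epsilon>) + (- u y - (norm (y - \<zeta>))\<^sup>2 / (2 * \<epsilon>))
      - (norm (\<xi> - \<zeta>))\<^sup>2 / (2 * \<epsilon>) - \<mu> * (norm (\<xi> - x0))\<^sup>2"
  shows "norm (x - \<xi>) \<le> 6 * L * \<epsilon>" "norm (y - \<zeta>) \<le> 6 * L * \<epsilon>" "norm (x - y) \<le> 6 * L * \<epsilon>"
    "\<mu> * (norm (\<xi> - x0))\<^sup>2 \<le> 6 * L\<^sup>2 * \<epsilon>"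
proof -
  define a b d where "a = norm (x - \<xi>)" and "b = norm (\<xi> - \<zeta>)" and "d = norm (y - \<zeta>)"
  define s where "s = a + b + d"
  have pos: "a \<ge> 0" "b \<ge> 0" "d \<ge> 0" by (auto simp: a_def b_def d_def)
  have "x - y = (x - \<xi>) + (\<xi> - \<zeta>) + (\<zeta> - y)" by simp
  then have "norm (x - y) \<le> norm (x - \<xi>) + norm (\<xi> - \<zeta>) + norm (\<zeta> - y)"
    by (metis norm_triangle_ineq norm_triangle_mono order_refl)
  then have xy: "norm (x - y) \<le> s" by (simp add: s_def a_def b_def d_def norm_minus_commute)
  have ulip: "u x - u y \<le> L * s"
    using lip mult_left_mono[OF xy L] by linarith
  have \<mu>0: "0 \<le> \<mu> * (norm (\<xi> - x0))\<^sup>2" using \<mu> by simp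
  have frac: "0 \<le> a\<^sup>2 / (2 * \<epsilon>)" "0 \<le> b\<^sup>2 / (2 * \<epsilon>)" "0 \<le> d\<^sup>2 / (2 * \<epsilon>)"
    using \<epsilon> by auto
  have "a\<^sup>2 / (2 * \<epsilon>) + b\<^sup>2 / (2 * \<epsilon>) + d\<^sup>2 / (2 * \<epsilon>) \<le> L * s"
    using ge ulip \<mu>0 unfolding a_def b_def d_def by linarith
  then have "(a\<^sup>2 + b\<^sup>2 + d\<^sup>2) / (2 * \<epsilon>) \<le> L * s" by (simp add: add_divide_distrib)
  then have 1: "a\<^sup>2 + b\<^sup>2 + d\<^sup>2 \<le> 2 * \<epsilon> * L * s" using \<epsilon> by (simp add: field_simps)
  have "s\<^sup>2 \<le> 3 * (a\<^sup>2 + b\<^sup>2 + d\<^sup>2)"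
  proof -
    have "3 * (a\<^sup>2 + b\<^sup>2 + d\<^sup>2) - s\<^sup>2 = (a - b)\<^sup>2 + (b - d)\<^sup>2 + (a - d)\<^sup>2"
      by (simp add: s_def power2_eq_square algebra_simps)
    also have "\<dots> \<ge> 0" by simp
    finally show ?thesis by simp
  qed
  also have "\<dots> \<le> (6 * L * \<epsilon>) * s" using 1 by (simp add: algebra_simps)
  finally have s6: "s \<le> 6 * L * \<epsilon>"
  proof (cases "s = 0")
    case False
    then have "s > 0" using pos by (simp add: s_def)
    moreover assume "s\<^sup>2 \<le> (6 * L * \<epsilon>) * s"
    ultimately show ?thesis by (simp add: power2_eq_square)
  qed (use L \<epsilon> in simp)
  show "norm (x - \<xi>) \<le> 6 * L * \<epsilon>" "norm (y - \<zeta>) \<le> 6 * L * \<epsilon>" "norm (x - y) \<le> 6 * L * \<epsilon>"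
    using s6 pos xy unfolding a_def b_def d_def s_def by linarith+
  have "\<mu> * (norm (\<xi> - x0))\<^sup>2 \<le> L * s"
    using ge ulip frac unfolding a_def b_def d_def by linarith
  also have "\<dots> \<le> L * (6 * L * \<epsilon>)" using s6 L by (rule mult_left_mono)
  finally show "\<mu> * (norm (\<xi> - x0))\<^sup>2 \<le> 6 * L\<^sup>2 * \<epsilon>" by (simp add: power2_eq_square algebra_simps)
qed

text \<open>The pair \<open>(x0, x0)\<close> has a nonnegative value, and by the doubling estimates
  all pairs with nonnegative value lie in the compact set \<open>?D\<close>; a maximum over
  \<open>?D\<close> is therefore global.\<close>

lemma exists_doubling_max:
  fixes u :: "'a::euclidean_space \<Rightarrow> real"
  assumes \<epsilon>: "\<epsilon> > 0" and L: "L \<ge> 0" and \<mu>: "\<mu> \<ge> 0" and r: "r > 0"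
    and lip: "\<And>x y. x \<in> cball x0 r \<Longrightarrow> y \<in> cball x0 r \<Longrightarrow> \<bar>u x - u y\<bar> \<le> L * norm (x - y)"
    and u: "continuous_on (cball x0 r) u"
  defines "w \<equiv> \<lambda>\<xi> \<zeta>. supconv (cball x0 r) \<epsilon> u \<xi> + supconv (cball x0 r) \<epsilon> (\<lambda>x. - u x) \<zeta>
      - (norm (\<xi> - \<zeta>))\<^sup>2 / (2 * \<epsilon>) - \<mu> * (norm (\<xi> - x0))\<^sup>2"
  obtains \<xi> \<zeta> where "\<And>\<xi>' \<zeta>'. w \<xi>' \<zeta>' \<le> w \<xi> \<zeta>" "0 \<le> w \<xi> \<zeta>"
proof -
  let ?R = "cball x0 r"
  have R: "compact ?R" "?R \<noteq> {}" using r by auto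
  have u': "continuous_on ?R (\<lambda>x. - u x)" by (intro continuous_intros u)
  define \<rho> where "\<rho> = r + 6 * L * \<epsilon>"
  have \<rho>: "\<rho> \<ge> 0" using r L \<epsilon> by (simp add: \<rho>_def)
  let ?D = "cball x0 \<rho> \<times> cball x0 \<rho>"
  have inD: "(\<xi>, \<zeta>) \<in> ?D" if "0 \<le> w \<xi> \<zeta>" for \<xi> \<zeta>
  proof -
    obtain x where x: "x \<in> ?R" "supconv ?R \<epsilon> u \<xi> = u x - (norm (x - \<xi>))\<^sup>2 / (2 * \<epsilon>)"
      using supconv_attained[OF R u \<epsilon>] by blast
    obtain y where y: "y \<in> ?R" "supconv ?R \<epsilon> (\<lambda>x. - u x) \<zeta> = - u y - (norm (y - \<zeta>))\<^sup>2 / (2 * \<epsilon>)"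
      using supconv_attained[OF R u' \<epsilon>] by blast
    note est = doubling_estimates[OF \<epsilon> L lip[OF x(1) y(1)] \<mu> that[unfolded w_def x(2) y(2)]]
    have "dist x0 \<xi> \<le> dist x0 x + dist x \<xi>" "dist x0 \<zeta> \<le> dist x0 y + dist y \<zeta>"
      by (rule dist_triangle)+
    then show ?thesis using est x(1) y(1) by (simp add: \<rho>_def dist_norm)
  qed
  have cu: "continuous_on UNIV (supconv ?R \<epsilon> u)" "continuous_on UNIV (supconv ?R \<epsilon> (\<lambda>x. - u x))"
    using continuous_on_supconv[OF R u \<epsilon>] continuous_on_supconv[OF R u' \<epsilon>] .
  have "continuous_on ?D (\<lambda>z. w (fst z) (snd z))"
    unfolding w_def using \<epsilon>
    by (intro continuous_intros continuous_on_compose2[OF cu(1)] continuous_on_compose2[OF cu(2)]) auto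
  moreover have "compact ?D" "?D \<noteq> {}" using \<rho> by (auto intro!: compact_Times)
  ultimately obtain z where z: "z \<in> ?D" "\<And>z'. z' \<in> ?D \<Longrightarrow> w (fst z') (snd z') \<le> w (fst z) (snd z)"
    using continuous_attains_sup[of ?D "\<lambda>z. w (fst z) (snd z)"] by blast
  have "0 \<le> w x0 x0"
    using supconv_upper[OF R u \<epsilon>, of x0 x0] supconv_upper[OF R u' \<epsilon>, of x0 x0] r by (simp add: w_def)
  also have "\<dots> \<le> w (fst z) (snd z)" using z(2)[of "(x0, x0)"] \<rho> by simp
  finally have z0: "0 \<le> w (fst z) (snd z)" .
  have "w \<xi>' \<zeta>' \<le> w (fst z) (snd z)" for \<xi>' \<zeta>'
    using inD[of \<xi>' \<zeta>'] z(2)[of "(\<xi>', \<zeta>')"] z0 by force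
  then show ?thesis using that z0 by blast
qed

text \<open>The two viscosity inequalities at the doubling maximum, added up. In the conclusion
  \<open>q\<close> is a slope of \<open>u\<close>, that is, minus the slope of \<open>- u\<close>
  called \<open>q\<close> in the proof. The two smallness conditions keep \<open>x\<close> and
  \<open>y\<close> inside the ball.\<close>

lemma doubling_inequality:
  fixes \<Omega> :: "(real^'n) set" and u f g :: "real^'n \<Rightarrow> real"
  assumes \<epsilon>: "\<epsilon> > 0" and L: "L \<ge> 0" and \<mu>: "\<mu> \<ge> 0" and r: "r > 0"
    and R: "cball x0 r \<subseteq> \<Omega>"
    and lip: "\<And>x y. x \<in> cball x0 r \<Longrightarrow> y \<in> cball x0 r \<Longrightarrow> \<bar>u x - u y\<bar> \<le> L * norm (x - y)"
    and contB: "continuous_on (\<Omega> \<times> UNIV \<times> UNIV) (\<lambda>(x, z, p). B x z p)"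
    and contc: "continuous_on (\<Omega> \<times> UNIV \<times> UNIV) (\<lambda>(x, z, p). c x z p)"
    and contf: "continuous_on \<Omega> f" and contg: "continuous_on \<Omega> g"
    and sub: "visc_sub \<Omega> B c f u" and super: "visc_super \<Omega> B c g u"
    and small1: "24 * L * \<epsilon> < r" and small2: "24 * L\<^sup>2 * \<epsilon> < \<mu> * r\<^sup>2"
  shows "\<exists>x\<in>cball x0 r. \<exists>y\<in>cball x0 r. \<exists>p q. norm (x - y) \<le> 6 * L * \<epsilon> \<and>
    norm p \<le> 6 * L \<and> norm q \<le> 6 * L \<and> norm (p - q) \<le> 2 * \<mu> * r \<and>
    f x - c x (u x) p - (g y - c y (u y) q)
      \<le> (norm (B x (u x) p - B y (u y) q))\<^sup>2 / \<epsilon> + 2 * \<mu> * (norm (B x (u x) p))\<^sup>2"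
proof -
  let ?R = "cball x0 r"
  have Rc: "compact ?R" "?R \<noteq> {}" using r by auto
  have uO: "continuous_on \<Omega> u" using sub by (simp add: visc_sub_def)
  have u: "continuous_on ?R u" using uO R continuous_on_subset by blast
  have u': "continuous_on ?R (\<lambda>x. - u x)" by (intro continuous_intros u)
  let ?U = "supconv ?R \<epsilon> u" and ?V = "supconv ?R \<epsilon> (\<lambda>x. - u x)"
  obtain \<xi> \<zeta> where max: "\<And>\<xi>' \<zeta>'. ?U \<xi>' + ?V \<zeta>' - (norm (\<xi>' - \<zeta>'))\<^sup>2 / (2 * \<epsilon>) - \<mu> * (norm (\<xi>' - x0))\<^sup>2
        \<le> ?U \<xi> + ?V \<zeta> - (norm (\<xi> - \<zeta>))\<^sup>2 / (2 * \<epsilon>) - \<mu> * (norm (\<xi> - x0))\<^sup>2"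
      and ge0: "0 \<le> ?U \<xi> + ?V \<zeta> - (norm (\<xi> - \<zeta>))\<^sup>2 / (2 * \<epsilon>) - \<mu> * (norm (\<xi> - x0))\<^sup>2"
    using exists_doubling_max[OF \<epsilon> L \<mu> r lip u] by metis
  obtain x where x: "x \<in> ?R" "?U \<xi> = u x - (norm (x - \<xi>))\<^sup>2 / (2 * \<epsilon>)"
    using supconv_attained[OF Rc u \<epsilon>] by blast
  obtain y where y: "y \<in> ?R" "?V \<zeta> = - u y - (norm (y - \<zeta>))\<^sup>2 / (2 * \<epsilon>)"
    using supconv_attained[OF Rc u' \<epsilon>] by blast
  note est = doubling_estimates[OF \<epsilon> L lip[OF x(1) y(1)] \<mu> ge0[unfolded x(2) y(2)]]
  have n2: "(norm (a + k))\<^sup>2 = (norm a)\<^sup>2 + 2 * (a \<bullet> k) + (norm k)\<^sup>2" for a k :: "real^'n"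
    by (simp add: power2_norm_eq_inner inner_simps inner_commute)
  \<comment> \<open>Maximality with the penalties expanded about \<open>(\<xi>, \<zeta>)\<close>;
    both the gradients and the second difference bound are read off from it.\<close>
  have quad: "?U (\<xi> + h) + ?V (\<zeta> + k) \<le> ?U \<xi> + ?V \<zeta> + ((\<xi> - \<zeta>) \<bullet> (h - k)) / \<epsilon> + (norm (h - k))\<^sup>2 / (2 * \<epsilon>)
      + \<mu> * (2 * ((\<xi> - x0) \<bullet> h) + (norm h)\<^sup>2)" for h k
  proof -
    have e: "\<xi> + h - (\<zeta> + k) = (\<xi> - \<zeta>) + (h - k)" "\<xi> + h - x0 = (\<xi> - x0) + h" by auto
    have f: "(s + 2 * t + v) / (2 * \<epsilon>) = s / (2 * \<epsilon>) + t / \<epsilon> + v / (2 * \<epsilon>)" for s t v :: real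
      using \<epsilon> by (simp add: field_simps)
    show ?thesis
      using max[of "\<xi> + h" "\<zeta> + k"] unfolding e n2 f by (simp add: algebra_simps)
  qed
  define p where "p = (x - \<xi>) /\<^sub>R \<epsilon>"
  define q where "q = (y - \<zeta>) /\<^sub>R \<epsilon>"
  \<comment> \<open>\<open>P\<close> and \<open>Q\<close> are the gradients of the penalty in \<xi>
    and in \<zeta>. They agree with the slopes \<open>p\<close> and \<open>q\<close> of the
    paraboloids from below, so \<open>p + q\<close> is the small vector
    \<open>(2 * \<mu>) *\<^sub>R (\<xi> - x0)\<close>.\<close>
  define P where "P = (\<xi> - \<zeta>) /\<^sub>R \<epsilon> + (2 * \<mu>) *\<^sub>R (\<xi> - x0)"
  define Q where "Q = - ((\<xi> - \<zeta>) /\<^sub>R \<epsilon>)"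
  have Ph: "P \<bullet> h = ((\<xi> - \<zeta>) \<bullet> h) / \<epsilon> + 2 * \<mu> * ((\<xi> - x0) \<bullet> h)" for h
    by (simp add: P_def inner_add_left divide_inverse_commute)
  have Qh: "Q \<bullet> h = - (((\<xi> - \<zeta>) \<bullet> h) / \<epsilon>)" for h
    by (simp add: Q_def inner_minus_left divide_inverse_commute)
  have upper_P: "?U (\<xi> + h) \<le> ?U \<xi> + P \<bullet> h + (1 / (2 * \<epsilon>) + \<mu>) * (norm h)\<^sup>2" for h
    using quad[of h 0] unfolding Ph by (simp add: distrib_left distrib_right)
  have upper_Q: "?V (\<zeta> + h) \<le> ?V \<zeta> + Q \<bullet> h + (1 / (2 * \<epsilon>)) * (norm h)\<^sup>2" for h
    using quad[of 0 h] unfolding Qh by simp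
  have "p - P = 0"
  proof (rule zero_if_inner_le_square[OF zero_less_one])
    show "(p - P) \<bullet> h \<le> (1 / (2 * \<epsilon>) + \<mu> + 1 / (2 * \<epsilon>)) * (norm h)\<^sup>2" for h
      using upper_P[of h] supconv_lower_paraboloid[OF Rc u \<epsilon> x, of h] unfolding p_def[symmetric]
      by (simp add: inner_diff_left distrib_right)
  qed
  then have p_eq: "p = P" by simp
  have "q - Q = 0"
  proof (rule zero_if_inner_le_square[OF zero_less_one])
    show "(q - Q) \<bullet> h \<le> (1 / (2 * \<epsilon>) + 1 / (2 * \<epsilon>)) * (norm h)\<^sup>2" for h
      using upper_Q[of h] supconv_lower_paraboloid[OF Rc u' \<epsilon> y, of h] unfolding q_def[symmetric]
      by (simp add: inner_diff_left distrib_right)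
  qed
  then have q_eq: "q = Q" by simp
  note upper_U = upper_P[folded p_eq] and upper_V = upper_Q[folded q_eq]
  have \<xi>r: "norm (\<xi> - x0) < r / 2"
  proof (rule ccontr)
    assume "\<not> ?thesis"
    then have "(r / 2)\<^sup>2 \<le> (norm (\<xi> - x0))\<^sup>2" using r by (intro power_mono) auto
    then have "\<mu> * (r / 2)\<^sup>2 \<le> 6 * L\<^sup>2 * \<epsilon>" using est(4) \<mu> by (meson mult_left_mono order_trans)
    then show False using small2 by (simp add: power_divide)
  qed
  have xint: "x \<in> interior ?R"
  proof -
    have "norm (x - x0) \<le> norm (x - \<xi>) + norm (\<xi> - x0)" using norm_triangle_ineq[of "x - \<xi>" "\<xi> - x0"] by simp
    then show ?thesis using \<xi>r est(1) small1 r by (simp add: dist_norm norm_minus_commute)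
  qed
  have yint: "y \<in> interior ?R"
  proof -
    have "norm (y - x0) \<le> norm (y - x) + (norm (x - \<xi>) + norm (\<xi> - x0))"
      using norm_triangle_ineq[of "x - \<xi>" "\<xi> - x0"] norm_triangle_ineq[of "y - x" "x - x0"] by simp
    then show ?thesis using \<xi>r est(1,3) small1 r by (simp add: dist_norm norm_minus_commute)
  qed
  define b1 where "b1 = B x (u x) p"
  define b2 where "b2 = B y (u y) (- q)"
  have intO: "interior ?R \<subseteq> \<Omega>" using R interior_subset by blast
  \<comment> \<open>Near interior points of the ball, touching relative to the ball is a local
    extremum relative to \<Omega>.\<close>
  have local: "\<exists>e'>0. \<Omega> \<inter> ball z e' \<subseteq> ?R \<inter> ball z e" if z: "z \<in> interior ?R" and e: "e > 0" for z e
  proof -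
    obtain e1 where "e1 > 0" "ball z e1 \<subseteq> interior ?R"
      using z open_interior open_contains_ball by blast
    then show ?thesis using e interior_subset[of ?R] by (intro exI[of _ "min e e1"]) auto
  qed
  \<comment> \<open>The factor \<open>s\<close> is 1 for \<open>u\<close> and -1 for
    \<open>- u\<close>, whose slopes have the opposite sign.\<close>
  have comp: "continuous_on (interior ?R \<times> UNIV) (\<lambda>z. F (fst z) (u (fst z)) (s *\<^sub>R snd z))"
    if "continuous_on (\<Omega> \<times> UNIV \<times> UNIV) (\<lambda>(x, z, p). F x z p)" for F :: "real^'n \<Rightarrow> real \<Rightarrow> real^'n \<Rightarrow> 'b::euclidean_space" and s
  proof -
    have "continuous_on (interior ?R \<times> (UNIV :: (real^'n) set)) (\<lambda>z. u (fst z))"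
      by (rule continuous_on_compose2[OF uO]) (use intO in \<open>auto intro!: continuous_intros\<close>)
    then have "continuous_on (interior ?R \<times> (UNIV :: (real^'n) set)) (\<lambda>z. (\<lambda>(x, z, p). F x z p) (fst z, u (fst z), s *\<^sub>R snd z))"
      by (intro continuous_on_compose2[OF that] continuous_intros) (use intO in auto)
    then show ?thesis by simp
  qed
  have cfst: "continuous_on (interior ?R \<times> (UNIV :: (real^'n) set)) (\<lambda>z. F (fst z))" if "continuous_on \<Omega> F" for F :: "real^'n \<Rightarrow> real"
    by (rule continuous_on_compose2[OF that]) (use intO in \<open>auto intro!: continuous_intros\<close>)
  have jetU: "\<exists>t0>0. \<forall>t. 0 < t \<and> t < t0 \<longrightarrow> f x - c x (u x) p \<le> (?U (\<xi> + t *\<^sub>R b1) + ?U (\<xi> - t *\<^sub>R b1) - 2 * ?U \<xi>) / t\<^sup>2 + \<eta>"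
    if \<eta>: "\<eta> > 0" for \<eta>
  proof -
    have "\<exists>t0>0. \<forall>t. 0 < t \<and> t < t0 \<longrightarrow> (\<lambda>z. f (fst z) - c (fst z) (u (fst z)) (1 *\<^sub>R snd z)) (x, p)
       \<le> (?U (\<xi> + t *\<^sub>R b1) + ?U (\<xi> - t *\<^sub>R b1) - 2 * ?U \<xi>) / t\<^sup>2 + \<eta>"
    proof (rule supconv_second_difference_ge[where \<beta> = "\<lambda>z. B (fst z) (u (fst z)) (1 *\<^sub>R snd z)",
          OF Rc(1) u \<epsilon> xint x(2) p_def upper_U comp[OF contB] continuous_on_diff[OF cfst[OF contf] comp[OF contc]] _ _ \<eta>])
      show "b1 = B (fst (x, p)) (u (fst (x, p))) (1 *\<^sub>R snd (x, p))" by (simp add: b1_def)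
    next
      fix x' q' \<alpha> M e
      assume x': "x' \<in> interior ?R" and e: "0 < (e::real)"
        and le: "\<forall>y\<in>?R \<inter> ball x' e. u y \<le> u x' + qtest q' \<alpha> M b1 x' y"
      obtain e' where "e' > 0" "\<Omega> \<inter> ball x' e' \<subseteq> ?R \<inter> ball x' e" using local[OF x' e] by blast
      then have "local_max_at \<Omega> (\<lambda>y. u y - qtest q' \<alpha> M b1 x' y) x'"
        unfolding local_max_at_def using le by (intro exI[of _ e']) force
      then have "f x' \<le> visc_op B c u (qtest q' \<alpha> M b1 x') x'"
        using sub x' intO Ck_on_2_qtest unfolding visc_sub_def by blast
      then show "(\<lambda>z. f (fst z) - c (fst z) (u (fst z)) (1 *\<^sub>R snd z)) (x', q')
          \<le> \<alpha> * (B (fst (x', q')) (u (fst (x', q'))) (1 *\<^sub>R snd (x', q')) \<bullet> b1)\<^sup>2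
            + 2 * M * (B (fst (x', q')) (u (fst (x', q'))) (1 *\<^sub>R snd (x', q')) \<bullet> B (fst (x', q')) (u (fst (x', q'))) (1 *\<^sub>R snd (x', q')))"
        by (simp add: visc_op_qtest)
    qed
    then show ?thesis by simp
  qed
  have jetV: "\<exists>t0>0. \<forall>t. 0 < t \<and> t < t0 \<longrightarrow> c y (u y) (- q) - g y \<le> (?V (\<zeta> + t *\<^sub>R b2) + ?V (\<zeta> - t *\<^sub>R b2) - 2 * ?V \<zeta>) / t\<^sup>2 + \<eta>"
    if \<eta>: "\<eta> > 0" for \<eta>
  proof -
    have "\<exists>t0>0. \<forall>t. 0 < t \<and> t < t0 \<longrightarrow> (\<lambda>z. c (fst z) (u (fst z)) ((- 1) *\<^sub>R snd z) - g (fst z)) (y, q)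
       \<le> (?V (\<zeta> + t *\<^sub>R b2) + ?V (\<zeta> - t *\<^sub>R b2) - 2 * ?V \<zeta>) / t\<^sup>2 + \<eta>"
    proof (rule supconv_second_difference_ge[where \<beta> = "\<lambda>z. B (fst z) (u (fst z)) ((- 1) *\<^sub>R snd z)",
          OF Rc(1) u' \<epsilon> yint y(2) q_def upper_V comp[OF contB] continuous_on_diff[OF comp[OF contc] cfst[OF contg]] _ _ \<eta>])
      show "b2 = B (fst (y, q)) (u (fst (y, q))) ((- 1) *\<^sub>R snd (y, q))" by (simp add: b2_def)
    next
      fix x' q' \<alpha> M e
      assume x': "x' \<in> interior ?R" and e: "0 < (e::real)"
        and le: "\<forall>y\<in>?R \<inter> ball x' e. - u y \<le> - u x' + qtest q' \<alpha> M b2 x' y"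
      obtain e' where "e' > 0" "\<Omega> \<inter> ball x' e' \<subseteq> ?R \<inter> ball x' e" using local[OF x' e] by blast
      then have "local_min_at \<Omega> (\<lambda>y. u y - qtest (- q') (- \<alpha>) (- M) b2 x' y) x'"
        unfolding local_min_at_def uminus_qtest[symmetric] using le by (intro exI[of _ e']) force
      then have "visc_op B c u (qtest (- q') (- \<alpha>) (- M) b2 x') x' \<le> g x'"
        using super x' intO Ck_on_2_qtest unfolding visc_super_def by blast
      then show "(\<lambda>z. c (fst z) (u (fst z)) ((- 1) *\<^sub>R snd z) - g (fst z)) (x', q')
          \<le> \<alpha> * (B (fst (x', q')) (u (fst (x', q'))) ((- 1) *\<^sub>R snd (x', q')) \<bullet> b2)\<^sup>2
            + 2 * M * (B (fst (x', q')) (u (fst (x', q'))) ((- 1) *\<^sub>R snd (x', q')) \<bullet> B (fst (x', q')) (u (fst (x', q'))) ((- 1) *\<^sub>R snd (x', q')))"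
        by (simp add: visc_op_qtest)
    qed
    then show ?thesis by simp
  qed
  have main: "f x - c x (u x) p - (g y - c y (u y) (- q)) \<le> (norm (b1 - b2))\<^sup>2 / \<epsilon> + 2 * \<mu> * (norm b1)\<^sup>2"
  proof (rule field_le_epsilon)
    fix \<eta> :: real assume \<eta>: "\<eta> > 0"
    obtain t1 where t1: "t1 > 0" "\<And>t. 0 < t \<Longrightarrow> t < t1 \<Longrightarrow>
        f x - c x (u x) p \<le> (?U (\<xi> + t *\<^sub>R b1) + ?U (\<xi> - t *\<^sub>R b1) - 2 * ?U \<xi>) / t\<^sup>2 + \<eta> / 2"
      using jetU[OF half_gt_zero[OF \<eta>]] by blast
    obtain t2 where t2: "t2 > 0" "\<And>t. 0 < t \<Longrightarrow> t < t2 \<Longrightarrow>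
        c y (u y) (- q) - g y \<le> (?V (\<zeta> + t *\<^sub>R b2) + ?V (\<zeta> - t *\<^sub>R b2) - 2 * ?V \<zeta>) / t\<^sup>2 + \<eta> / 2"
      using jetV[OF half_gt_zero[OF \<eta>]] by blast
    define t where "t = min t1 t2 / 2"
    have t: "0 < t" "t < t1" "t < t2" using t1(1) t2(1) by (auto simp: t_def min_def)
    have "?U (\<xi> + t *\<^sub>R b1) + ?U (\<xi> - t *\<^sub>R b1) - 2 * ?U \<xi> + (?V (\<zeta> + t *\<^sub>R b2) + ?V (\<zeta> - t *\<^sub>R b2) - 2 * ?V \<zeta>)
        \<le> 2 * ((norm (t *\<^sub>R (b1 - b2)))\<^sup>2 / (2 * \<epsilon>) + \<mu> * (norm (t *\<^sub>R b1))\<^sup>2)"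
    proof -
      \<comment> \<open>The two opposite translates cancel the first-order terms, and the shifts
        enter the coupling penalty only through \<open>b1 - b2\<close>.\<close>
      have e: "- (t *\<^sub>R b1) - - (t *\<^sub>R b2) = - (t *\<^sub>R (b1 - b2))" "t *\<^sub>R b1 - t *\<^sub>R b2 = t *\<^sub>R (b1 - b2)"
        by (auto simp: algebra_simps)
      show ?thesis
        using quad[of "t *\<^sub>R b1" "t *\<^sub>R b2"] quad[of "- (t *\<^sub>R b1)" "- (t *\<^sub>R b2)"]
        unfolding e norm_minus_cancel inner_minus_right add_uminus_conv_diff minus_divide_left[symmetric]
          distrib_left mult_minus_right
        by linarith
    qed
    also have "\<dots> = t\<^sup>2 * ((norm (b1 - b2))\<^sup>2 / \<epsilon> + 2 * \<mu> * (norm b1)\<^sup>2)"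
      unfolding norm_scaleR power_mult_distrib power2_abs using \<epsilon> by (simp add: field_simps)
    finally have "(?U (\<xi> + t *\<^sub>R b1) + ?U (\<xi> - t *\<^sub>R b1) - 2 * ?U \<xi>) / t\<^sup>2 + (?V (\<zeta> + t *\<^sub>R b2) + ?V (\<zeta> - t *\<^sub>R b2) - 2 * ?V \<zeta>) / t\<^sup>2
        \<le> (norm (b1 - b2))\<^sup>2 / \<epsilon> + 2 * \<mu> * (norm b1)\<^sup>2"
      unfolding add_divide_distrib[symmetric] using t(1) by (simp add: pos_divide_le_eq mult.commute)
    then show "f x - c x (u x) p - (g y - c y (u y) (- q)) \<le> (norm (b1 - b2))\<^sup>2 / \<epsilon> + 2 * \<mu> * (norm b1)\<^sup>2 + \<eta>"
      using t1(2)[OF t(1,2)] t2(2)[OF t(1,3)] by linarith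
  qed
  have "p - - q = (2 * \<mu>) *\<^sub>R (\<xi> - x0)" by (simp add: p_eq q_eq P_def Q_def)
  then have "norm (p - - q) = 2 * \<mu> * norm (\<xi> - x0)" using \<mu> by simp
  also have "\<dots> \<le> 2 * \<mu> * r" using \<xi>r r \<mu> by (intro mult_left_mono) auto
  finally have pq: "norm (p - - q) \<le> 2 * \<mu> * r" .
  have "norm p \<le> 6 * L" "norm (- q) \<le> 6 * L"
    unfolding p_def q_def norm_minus_cancel norm_scaleR using est(1,2) \<epsilon> by (simp_all add: field_simps)
  with est(3) pq main x(1) y(1) show ?thesis unfolding b1_def b2_def by blast
qed

section \<open>Lipschitz continuity of the direction field and the contradiction\<close>

lemma C1_on_imp_continuous_on: "C1_on S F \<Longrightarrow> continuous_on S F"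
  unfolding C1_on_def by (metis continuous_at_imp_continuous_on has_derivative_continuous)

text \<open>The mean value inequality on a convex set. The linear rate makes the square of the
  difference of directions, divided by \<epsilon>, of order \<epsilon>.\<close>

lemma C1_on_lipschitz_on_compact:
  assumes "C1_on S F" "compact Q" "convex Q" "Q \<subseteq> S"
  obtains K where "K \<ge> 0" "\<And>x y. x \<in> Q \<Longrightarrow> y \<in> Q \<Longrightarrow> norm (F x - F y) \<le> K * norm (x - y)"
proof -
  obtain F' where F': "\<And>z. z \<in> S \<Longrightarrow> (F has_derivative blinfun_apply (F' z)) (at z)" "continuous_on S F'"
    using assms(1) unfolding C1_on_def by blast
  have "bounded (F' ` Q)"
    by (intro compact_imp_bounded compact_continuous_image continuous_on_subset[OF F'(2)] assms)
  then obtain K where K: "K > 0" "\<And>z. z \<in> Q \<Longrightarrow> norm (F' z) \<le> K"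
    by (auto simp: bounded_pos)
  have "norm (F x - F y) \<le> K * norm (x - y)" if "x \<in> Q" "y \<in> Q" for x y
  proof (rule differentiable_bound[OF assms(3) _ _ that])
    show "(F has_derivative blinfun_apply (F' z)) (at z within Q)" if "z \<in> Q" for z
      using that assms(4) F'(1) by (blast intro: has_derivative_at_withinI)
    show "onorm (blinfun_apply (F' z)) \<le> K" if "z \<in> Q" for z
      using K(2)[OF that] by (simp add: norm_blinfun.rep_eq)
  qed
  with K(1) that show ?thesis by (meson less_imp_le)
qed

theorem theorem1p1:
  fixes \<Omega> :: "(real^'n) set"
    and B :: "real^'n \<Rightarrow> real \<Rightarrow> real^'n \<Rightarrow> real^'n"
    and c :: "real^'n \<Rightarrow> real \<Rightarrow> real^'n \<Rightarrow> real"
    and f g u :: "real^'n \<Rightarrow> real"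
  assumes "open \<Omega>"
    and "C1_on (\<Omega> \<times> UNIV \<times> UNIV) (\<lambda>(x, z, p). B x z p)"
    and "continuous_on (\<Omega> \<times> UNIV \<times> UNIV) (\<lambda>(x, z, p). c x z p)"
    and "continuous_on \<Omega> f" and "continuous_on \<Omega> g"
    and "W1inf_loc \<Omega> u"
    and "visc_sub \<Omega> B c f u"
    and "visc_super \<Omega> B c g u"
  shows "\<forall>x\<in>\<Omega>. f x \<le> g x"
proof (rule ballI, rule ccontr)
  fix x0 assume x0: "x0 \<in> \<Omega>" and "\<not> f x0 \<le> g x0"
  define \<kappa> where "\<kappa> = f x0 - g x0"
  have \<kappa>: "\<kappa> > 0" using \<open>\<not> f x0 \<le> g x0\<close> by (simp add: \<kappa>_def)
  obtain r0 L where r0: "r0 > 0" "L \<ge> 0" "cball x0 r0 \<subseteq> \<Omega>"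
    and lip0: "\<And>x y. x \<in> cball x0 r0 \<Longrightarrow> y \<in> cball x0 r0 \<Longrightarrow> \<bar>u x - u y\<bar> \<le> L * norm (x - y)"
    using W1inf_loc_imp_lipschitz_near[OF assms(1,6) x0] by blast
  have near: "\<exists>d>0. \<forall>x\<in>\<Omega>. dist x x0 < d \<longrightarrow> dist (h x) (h x0) < \<kappa> / 4" if "continuous_on \<Omega> h" for h :: "real^'n \<Rightarrow> real"
    using that x0 \<kappa> unfolding continuous_on_iff by (metis zero_less_divide_iff zero_less_numeral)
  obtain d1 d2 where d1: "d1 > 0" "\<And>x. x \<in> \<Omega> \<Longrightarrow> dist x x0 < d1 \<Longrightarrow> \<bar>f x - f x0\<bar> < \<kappa> / 4"
    and d2: "d2 > 0" "\<And>x. x \<in> \<Omega> \<Longrightarrow> dist x x0 < d2 \<Longrightarrow> \<bar>g x - g x0\<bar> < \<kappa> / 4"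
    using near[OF assms(4)] near[OF assms(5)] unfolding dist_real_def by metis
  define r where "r = min r0 (min d1 d2 / 2)"
  have r: "r > 0" "r \<le> r0" "r < d1" "r < d2" using r0 d1(1) d2(1) by (auto simp: r_def min_def)
  let ?R = "cball x0 r"
  have R: "?R \<subseteq> \<Omega>" "?R \<subseteq> cball x0 r0" using r r0 by auto
  have lip: "\<bar>u x - u y\<bar> \<le> L * norm (x - y)" if "x \<in> ?R" "y \<in> ?R" for x y
    using that R(2) by (intro lip0) auto
  \<comment> \<open>A compact convex set, independent of \<epsilon>, that contains all arguments of
    \<open>B\<close> and \<open>c\<close> arising from the doubling.\<close>
  define Q where "Q = ?R \<times> cball (u x0) (L * r) \<times> cball (0 :: real^'n) (6 * L)"
  have Q: "compact Q" "convex Q" "Q \<subseteq> \<Omega> \<times> UNIV \<times> UNIV"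
    unfolding Q_def using R(1) by (auto intro!: compact_Times convex_Times)
  have uR: "u x \<in> cball (u x0) (L * r)" if "x \<in> ?R" for x
  proof -
    have "\<bar>u x0 - u x\<bar> \<le> L * norm (x0 - x)" using r that by (intro lip) auto
    also have "\<dots> \<le> L * r" using that r0(2) by (intro mult_left_mono) (auto simp: dist_norm)
    finally show ?thesis by (simp add: dist_real_def)
  qed
  obtain KB where KB: "KB \<ge> 0" "\<And>z z'. z \<in> Q \<Longrightarrow> z' \<in> Q \<Longrightarrow>
      norm ((\<lambda>(x, z, p). B x z p) z - (\<lambda>(x, z, p). B x z p) z') \<le> KB * norm (z - z')"
    using C1_on_lipschitz_on_compact[OF assms(2) Q] by blast
  have contB: "continuous_on (\<Omega> \<times> UNIV \<times> UNIV) (\<lambda>(x, z, p). B x z p)"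
    using assms(2) by (rule C1_on_imp_continuous_on)
  have "bounded ((\<lambda>(x, z, p). B x z p) ` Q)"
    by (intro compact_imp_bounded compact_continuous_image continuous_on_subset[OF contB] Q)
  then obtain N where N: "N > 0" "\<And>z. z \<in> Q \<Longrightarrow> norm ((\<lambda>(x, z, p). B x z p) z) \<le> N"
    unfolding bounded_pos by blast
  have "uniformly_continuous_on Q (\<lambda>(x, z, p). c x z p)"
    by (intro compact_uniformly_continuous continuous_on_subset[OF assms(3)] Q)
  then obtain d where d: "d > 0" "\<And>z z'. z \<in> Q \<Longrightarrow> z' \<in> Q \<Longrightarrow> dist z' z < d \<Longrightarrow>
      dist ((\<lambda>(x, z, p). c x z p) z') ((\<lambda>(x, z, p). c x z p) z) < \<kappa> / 8"
    by (rule uniformly_continuous_onE[of _ _ "\<kappa> / 8"]) (use \<kappa> in auto)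
  \<comment> \<open>With \<open>\<mu> = K * \<epsilon>\<close> the second smallness condition reads
    \<open>24 * L\<^sup>2 < K * r\<^sup>2\<close> and holds for every \<epsilon>.\<close>
  define K where "K = (24 * L\<^sup>2 + 1) / r\<^sup>2"
  have K: "K > 0" "K * r\<^sup>2 = 24 * L\<^sup>2 + 1" using r by (auto simp: K_def add_nonneg_pos)
  \<comment> \<open>The three terms come from the differences of the points, of the values of
    \<open>u\<close> and of the slopes.\<close>
  define D where "D = 6 * L + 6 * L\<^sup>2 + 2 * K * r"
  have D: "D \<ge> 0" using r0(2) K r by (simp add: D_def)
  \<comment> \<open>Exceeds every factor of \<epsilon> that has to be made small, so
    \<open>\<epsilon> = m / E\<close> brings all these products below \<open>m\<close> at
    once.\<close>
  define E where "E = 1 + D + (KB * D)\<^sup>2 + 2 * K * N\<^sup>2 + 24 * L"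
  have E: "E \<ge> 1" "D < E" "(KB * D)\<^sup>2 + 2 * K * N\<^sup>2 < E" "24 * L < E"
    using D K r0(2) by (auto simp: E_def add_nonneg_pos add_pos_nonneg)
  define m where "m = min (\<kappa> / 8) (min d r)"
  have m: "m > 0" "m \<le> \<kappa> / 8" "m \<le> d" "m \<le> r" using \<kappa> d(1) r by (auto simp: m_def)
  define \<epsilon> where "\<epsilon> = m / E"
  have \<epsilon>: "\<epsilon> > 0" using m E(1) by (simp add: \<epsilon>_def)
  have le_m: "s * \<epsilon> < m" if "s < E" for s
    using that E(1) m(1) by (simp add: \<epsilon>_def field_simps)
  have small1: "24 * L * \<epsilon> < r" using le_m[OF E(4)] m(4) by linarith
  have small2: "24 * L\<^sup>2 * \<epsilon> < K * \<epsilon> * r\<^sup>2"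
  proof -
    have "K * \<epsilon> * r\<^sup>2 = (24 * L\<^sup>2 + 1) * \<epsilon>" unfolding K(2)[symmetric] by simp
    then show ?thesis using \<epsilon> by (simp add: distrib_right)
  qed
  have K\<epsilon>: "K * \<epsilon> \<ge> 0" using K \<epsilon> by simp
  obtain x y p q where xy: "x \<in> ?R" "y \<in> ?R" "norm (x - y) \<le> 6 * L * \<epsilon>"
    and pq: "norm p \<le> 6 * L" "norm q \<le> 6 * L" "norm (p - q) \<le> 2 * (K * \<epsilon>) * r"
    and main: "f x - c x (u x) p - (g y - c y (u y) q)
      \<le> (norm (B x (u x) p - B y (u y) q))\<^sup>2 / \<epsilon> + 2 * (K * \<epsilon>) * (norm (B x (u x) p))\<^sup>2"
    using doubling_inequality[OF \<epsilon> r0(2) K\<epsilon> r(1) R(1) lip contB assms(3,4,5,7,8) small1 small2] by blast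
  let ?z = "(x, u x, p)" and ?z' = "(y, u y, q)"
  have zQ: "?z \<in> Q" "?z' \<in> Q" using xy pq uR by (auto simp: Q_def)
  have dz: "norm (?z - ?z') \<le> D * \<epsilon>"
  proof -
    have "norm (?z - ?z') \<le> norm (x - y) + (norm (u x - u y) + norm (p - q))"
      using norm_Pair_le[of "x - y" "(u x - u y, p - q)"] norm_Pair_le[of "u x - u y" "p - q"] by simp
    also have "\<dots> \<le> 6 * L * \<epsilon> + (L * (6 * L * \<epsilon>) + 2 * (K * \<epsilon>) * r)"
    proof (intro add_mono xy(3) pq(3))
      show "norm (u x - u y) \<le> L * (6 * L * \<epsilon>)"
        using lip[OF xy(1,2)] mult_left_mono[OF xy(3) r0(2)] by simp
    qed
    also have "\<dots> = D * \<epsilon>" by (simp add: D_def power2_eq_square algebra_simps)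
    finally show ?thesis .
  qed
  have "\<bar>c x (u x) p - c y (u y) q\<bar> < \<kappa> / 8"
  proof -
    have "dist ?z ?z' < d" using dz le_m[OF E(2)] m(3) by (simp add: dist_norm)
    from d(2)[OF zQ(2,1) this] show ?thesis by (simp add: dist_real_def)
  qed
  moreover have "(norm (B x (u x) p - B y (u y) q))\<^sup>2 / \<epsilon> + 2 * (K * \<epsilon>) * (norm (B x (u x) p))\<^sup>2 < \<kappa> / 8"
  proof -
    have "norm (B x (u x) p - B y (u y) q) \<le> KB * (D * \<epsilon>)"
      using KB(2)[OF zQ] mult_left_mono[OF dz KB(1)] by simp
    then have "(norm (B x (u x) p - B y (u y) q))\<^sup>2 \<le> (KB * (D * \<epsilon>))\<^sup>2"
      by (intro power_mono) auto
    then have 1: "(norm (B x (u x) p - B y (u y) q))\<^sup>2 / \<epsilon> \<le> (KB * D)\<^sup>2 * \<epsilon>"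
      using \<epsilon> by (simp add: field_simps power2_eq_square)
    have "(norm (B x (u x) p))\<^sup>2 \<le> N\<^sup>2" using N(2)[OF zQ(1)] by (intro power_mono) auto
    then have "2 * (K * \<epsilon>) * (norm (B x (u x) p))\<^sup>2 \<le> 2 * (K * \<epsilon>) * N\<^sup>2"
      using K\<epsilon> by (intro mult_left_mono) auto
    with 1 have "(norm (B x (u x) p - B y (u y) q))\<^sup>2 / \<epsilon> + 2 * (K * \<epsilon>) * (norm (B x (u x) p))\<^sup>2
        \<le> ((KB * D)\<^sup>2 + 2 * K * N\<^sup>2) * \<epsilon>" by (simp add: algebra_simps)
    also have "\<dots> < \<kappa> / 8" using le_m[OF E(3)] m(2) by linarith
    finally show ?thesis .
  qed
  moreover have "\<bar>f x - f x0\<bar> < \<kappa> / 4" "\<bar>g y - g x0\<bar> < \<kappa> / 4"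
    using d1(2)[of x] d2(2)[of y] xy R(1) r by (auto simp: dist_commute)
  \<comment> \<open>The bounds near \<open>x0\<close> give \<open>f x - g y > \<kappa> / 2\<close>,
    while the doubling inequality gives \<open>f x - g y < \<kappa> / 4\<close>.\<close>
  ultimately show False
    using main \<kappa> unfolding abs_less_iff by (simp add: \<kappa>_def field_simps)
qed

end
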